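(* Let $p\in(0,1)$ and let $(G_N)$ be a sequence of configuration models $\mathrm{CM}_N(\mathbf 1,\mathbf 2)$. Then, for all $\beta\ge0$, $B\in\mathbb R$ and for any $\varepsilon>0$, there exists a number $L=L(\varepsilon)>0$ such that $$\widetilde P_N\Big(\Big|\frac{S_N}{N}-\widetilde M\Big|\ge\varepsilon\Big)\le e^{-NL}\qquad\text{for all sufficiently large }N,$$ where $\widetilde M=\widetilde M(\beta,B)=\lim_{N\to\infty}\widetilde P_N(S_N/N)$ is the annealed magnetization.
   Context: Configuration model: given degrees $(d_i)_{i\in[N]}$ with even sum, attach $d_i$ half-edges to vertex $i\in[N]=\{1,\dots,N\}$ and pair all half-edges uniformly at random; each pair forms an edge, giving a random multigraph (self-loops and multiple edges allowed). $\mathrm{CM}_N(\mathbf 1,\mathbf 2)$ has $n_2=\lfloor pN\rfloor$ vertices of degree 2 and $n_1=N-\lfloor pN\rfloor$ vertices of degree 1; the total degree $N+\lfloor pN\rfloor$ is assumed even (equivalently $n_1$ even), and $N\to\infty$ along such $N$. Annealed Ising model: let $Q_N$ denote the law of the random multigraph $G_N=([N],E_N)$ and also the corresponding expectation; $E_N$ is counted with multiplicity, and a self-loop at $i$ contributes a term $\sigma_i\sigma_i=1$ once. For $\beta\ge0$, $B\in\mathbb R$ the annealed measure on $\sigma\in\{-1,1\}^N$ is $$\widetilde P_N(\sigma)=\frac{Q_N\big(\exp[\beta\sum_{(i,j)\in E_N}\sigma_i\sigma_j+B\sum_{i\in[N]}\sigma_i]\big)}{Q_N(Z_N(\beta,B))},\qquad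 Z_N(\beta,B)=\sum_{\sigma\in\{-1,1\}^N}\exp\Big[\beta\sum_{(i,j)\in E_N}\sigma_i\sigma_j+B\sum_{i\in[N]}\sigma_i\Big].$$ $\widetilde P_N(\cdot)$ also denotes expectation; $S_N=\sum_{i\in[N]}\sigma_i$ is the total spin. The limit $\widetilde M(\beta,B)=\lim_{N\to\infty}\widetilde P_N(S_N/N)$ exists. *)

theory Defs
  imports "HOL-Probability.Probability" "HOL-Library.Disjoint_Sets" "HOL-Library.Multiset"
begin

text \<open>
  The half-edges attached to vertex \<open>i\<close> are \<open>(i, 0), \<dots>, (i, d i - 1)\<close>; a pairing is a partition
  of the set of half-edges into two-element blocks.
\<close>

definition half_edges :: "nat \<Rightarrow> (nat \<Rightarrow> nat) \<Rightarrow> (nat \<times> nat) set" where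
  "half_edges N d = (SIGMA i:{1..N}. {..<d i})"

definition pairings :: "'a set \<Rightarrow> 'a set set set" where
  "pairings H = {P. partition_on H P \<and> (\<forall>e\<in>P. card e = 2)}"

text \<open>
  A multigraph is given by its multiset of edges, an edge being the two-element multiset of its
  endpoints, so that a self-loop at \<open>i\<close> is \<open>{#i, i#}\<close>.
\<close>

type_synonym multigraph = "nat multiset multiset"

definition pairing_graph :: "(nat \<times> nat) set set \<Rightarrow> multigraph" where
  "pairing_graph P = image_mset (\<lambda>e. image_mset fst (mset_set e)) (mset_set P)"

text \<open>
  For even total degree the set of pairings is finite and nonempty (see \<open>finite_pairings\<close> and
  \<open>pairings_nonempty\<close>); for odd total degree it is empty and the following law is meaningless.
\<close>

definition config_model :: "nat \<Rightarrow> (nat \<Rightarrow> nat) \<Rightarrow> multigraph pmf" where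
  "config_model N d = map_pmf pairing_graph (pmf_of_set (pairings (half_edges N d)))"

definition degrees12 :: "real \<Rightarrow> nat \<Rightarrow> (nat \<Rightarrow> nat) \<Rightarrow> bool" where
  "degrees12 p N d \<longleftrightarrow> (\<forall>i\<in>{1..N}. d i = 1 \<or> d i = 2) \<and>
     card {i\<in>{1..N}. d i = 2} = nat \<lfloor>p * real N\<rfloor>"

definition even_total_degree :: "real \<Rightarrow> nat set" where
  "even_total_degree p = {N. even (N + nat \<lfloor>p * real N\<rfloor>)}"

text \<open>The filter of \<open>N \<rightarrow> \<infinity>\<close> along those \<open>N\<close> for which the total degree is even.\<close>

definition admissible :: "real \<Rightarrow> nat filter" where
  "admissible p = inf sequentially (principal (even_total_degree p))"

definition spins :: "nat \<Rightarrow> (nat \<Rightarrow> real) set" where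
  "spins N = {1..N} \<rightarrow>\<^sub>E {-1, 1}"

definition total_spin :: "nat \<Rightarrow> (nat \<Rightarrow> real) \<Rightarrow> real" where
  "total_spin N \<sigma> = (\<Sum>i\<in>{1..N}. \<sigma> i)"

text \<open>For an edge \<open>{#i, j#}\<close> the inner product is \<open>\<sigma> i * \<sigma> j\<close>, also when \<open>i = j\<close>.\<close>

definition boltzmann :: "real \<Rightarrow> real \<Rightarrow> nat \<Rightarrow> multigraph \<Rightarrow> (nat \<Rightarrow> real) \<Rightarrow> real" where
  "boltzmann \<beta> B N E \<sigma> = exp (\<beta> * (\<Sum>e\<in>#E. \<Prod>i\<in>#e. \<sigma> i) + B * total_spin N \<sigma>)"

definition partition_function :: "real \<Rightarrow> real \<Rightarrow> nat \<Rightarrow> multigraph \<Rightarrow> real" where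
  "partition_function \<beta> B N E = (\<Sum>\<sigma>\<in>spins N. boltzmann \<beta> B N E \<sigma>)"

definition annealed_weight ::
    "nat \<Rightarrow> (nat \<Rightarrow> nat) \<Rightarrow> real \<Rightarrow> real \<Rightarrow> (nat \<Rightarrow> real) \<Rightarrow> real" where
  "annealed_weight N d \<beta> B \<sigma> =
     measure_pmf.expectation (config_model N d) (\<lambda>E. boltzmann \<beta> B N E \<sigma>) /
     measure_pmf.expectation (config_model N d) (\<lambda>E. partition_function \<beta> B N E)"

definition annealed_measure ::
    "nat \<Rightarrow> (nat \<Rightarrow> nat) \<Rightarrow> real \<Rightarrow> real \<Rightarrow> (nat \<Rightarrow> real) measure" where
  "annealed_measure N d \<beta> B =
     point_measure (spins N) (\<lambda>\<sigma>. ennreal (annealed_weight N d \<beta> B \<sigma>))"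

definition annealed_magnetization :: "real \<Rightarrow> (nat \<Rightarrow> nat \<Rightarrow> nat) \<Rightarrow> real \<Rightarrow> real \<Rightarrow> real" where
  "annealed_magnetization p d \<beta> B =
     Lim (admissible p)
       (\<lambda>N. integral\<^sup>L (annealed_measure N (d N) \<beta> B) (\<lambda>\<sigma>. total_spin N \<sigma> / real N))"

lemma finite_pairings:
  assumes "finite H" shows "finite (pairings H)"
proof (rule finite_subset)
  show "pairings H \<subseteq> Pow (Pow H)"
    by (auto simp: pairings_def partition_on_def)
qed (use assms in simp)

lemma pairings_nonempty:
  assumes "finite H" "even (card H)" shows "pairings H \<noteq> {}"
  using assms
proof (induction "card H" arbitrary: H rule: less_induct)
  case less
  show ?case
  proof (cases "H = {}")
    case True
    then have "{} \<in> pairings H" by (simp add: pairings_def partition_on_def)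
    then show ?thesis by blast
  next
    case False
    then obtain a where a: "a \<in> H" by blast
    have "card H \<noteq> 1" using less.prems by auto
    then have "H \<noteq> {a}" by auto
    then obtain b where b: "b \<in> H" "b \<noteq> a" using a by blast
    have c: "card (H - {a, b}) = card H - 2"
      using a b less.prems by (subst card_Diff_subset) auto
    have "card H > 0" using a less.prems card_gt_0_iff by blast
    with c have "pairings (H - {a, b}) \<noteq> {}"
      using less.prems by (intro less.hyps) auto
    then obtain P where P: "partition_on (H - {a, b}) P" "\<forall>e\<in>P. card e = 2"
      by (auto simp: pairings_def)
    have "partition_on H (insert {a, b} P)"
    proof (subst partition_on_insert)
      show "disjnt {a, b} (\<Union> P)"
        using partition_onD1[OF P(1)] by (auto simp: disjnt_def)
    qed (use P(1) a b in auto)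
    with P(2) b have "insert {a, b} P \<in> pairings H" by (auto simp: pairings_def)
    then show ?thesis by blast
  qed
qed

lemma finite_half_edges: "finite (half_edges N d)"
  by (simp add: half_edges_def)

lemma card_half_edges_degrees12:
  assumes "degrees12 p N d"
  shows "card (half_edges N d) = N + nat \<lfloor>p * real N\<rfloor>"
proof -
  have "card (half_edges N d) = (\<Sum>i\<in>{1..N}. d i)" by (simp add: half_edges_def)
  also have "\<dots> = (\<Sum>i\<in>{1..N}. 1 + (if d i = 2 then 1 else 0))"
    using assms by (intro sum.cong) (auto simp: degrees12_def)
  also have "\<dots> = N + card {i\<in>{1..N}. d i = 2}"
    by (subst sum.distrib, subst sum.If_cases) (simp_all add: Int_def)
  finally show ?thesis using assms by (simp add: degrees12_def)
qed

lemma prob_space_annealed_measure: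
  assumes "degrees12 p N d" "N \<in> even_total_degree p"
  shows "prob_space (annealed_measure N d \<beta> B)"
proof
  let ?X = "pairings (half_edges N d)" and ?Q = "config_model N d"
  have ne: "?X \<noteq> {}"
    using assms by (intro pairings_nonempty)
      (auto simp: finite_half_edges card_half_edges_degrees12 even_total_degree_def)
  have "finite (set_pmf ?Q)"
    using ne by (simp add: config_model_def finite_pairings finite_half_edges)
  then have int: "integrable (measure_pmf ?Q) f" for f :: "multigraph \<Rightarrow> real"
    by (rule integrable_measure_pmf_finite)
  let ?a = "\<lambda>\<sigma>. measure_pmf.expectation ?Q (\<lambda>E. boltzmann \<beta> B N E \<sigma>)"
  let ?Z = "measure_pmf.expectation ?Q (\<lambda>E. partition_function \<beta> B N E)"
  have fin: "finite (spins N)" by (auto simp: spins_def intro: finite_PiE)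
  have nes: "spins N \<noteq> {}" by (auto simp: spins_def PiE_eq_empty_iff)
  have Z: "?Z = (\<Sum>\<sigma>\<in>spins N. ?a \<sigma>)"
    unfolding partition_function_def by (intro Bochner_Integration.integral_sum int)
  have pos: "?a \<sigma> > 0" for \<sigma>
  proof -
    have "measure_pmf.expectation ?Q (\<lambda>E. 0) < ?a \<sigma>"
      by (rule measure_pmf.integral_less_AE_space)
        (simp_all add: int boltzmann_def measure_pmf.emeasure_space_1)
    then show ?thesis by simp
  qed
  have Zpos: "?Z > 0" unfolding Z using fin nes pos by (intro sum_pos) auto
  have w: "annealed_weight N d \<beta> B \<sigma> \<ge> 0" for \<sigma>
    unfolding annealed_weight_def using pos[of \<sigma>] Zpos by simp
  have "emeasure (annealed_measure N d \<beta> B) (spins N) =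
        (\<Sum>\<sigma>\<in>spins N. ennreal (annealed_weight N d \<beta> B \<sigma>))"
    unfolding annealed_measure_def by (rule emeasure_point_measure_finite) (auto simp: fin)
  also have "\<dots> = ennreal (\<Sum>\<sigma>\<in>spins N. annealed_weight N d \<beta> B \<sigma>)"
    using w by (simp add: sum_ennreal)
  also have "(\<Sum>\<sigma>\<in>spins N. annealed_weight N d \<beta> B \<sigma>) = 1"
    unfolding annealed_weight_def using Zpos by (simp flip: sum_divide_distrib Z)
  finally show "emeasure (annealed_measure N d \<beta> B) (space (annealed_measure N d \<beta> B)) = 1"
    by (simp add: annealed_measure_def space_point_measure)
qed

end

theory Submission
  imports Defs
begin

text \<open>
  A multigraph with degrees 1 and 2 is a disjoint union of paths and cycles, so annealing
  leaves a one-dimensional model that can be solved by transfer matrices. Suppose there are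
  \<open>2 * m\<close> vertices of degree 1 and \<open>n\<close> of degree 2.

  The sum of the Boltzmann weights over all pairings of the half-edges depends on the spins
  through the number of half-edges of either spin only (\<open>pairing_sum_spins\<close>), and it satisfies
  the recursion of Gaussian moments. Summing over the spins and following the path through a
  leaf with Wick's rule (\<open>leaf_op_vertex_sum\<close>) shows that the annealed partition function is,
  up to a factor free of the external field \<open>B\<close>, the coefficient of \<open>z ^ n\<close> in \<open>g z * F z ^ m\<close>
  (\<open>graph_sum_Suc\<close>, \<open>mean_partition_eq_graph_sum\<close>). Here \<open>F\<close> generates the partition functions
  of paths; it is an explicit rational function whose coefficients are positive and which has
  a pole at the inverse of the top eigenvalue of the transfer matrix (\<open>line_weight_sums\<close>,
  \<open>line_gf_unbounded\<close>). The series \<open>g\<close> accounts for the cycles.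

  For every \<open>z\<close> below the pole the coefficient is at most a constant times \<open>F z ^ m / z ^ n\<close>
  (\<open>convolution_recursion_upper\<close>). At the saddle point \<open>x\<close>, where \<open>z * F' z / F z\<close> first
  reaches the limit of \<open>n / m\<close>, this is sharp up to a subexponential factor
  (\<open>fps_power_coefficient_asymp_ge\<close>).

  The moment generating function of the total spin at \<open>t\<close> is the ratio of the annealed
  partition functions for \<open>B + t\<close> and \<open>B\<close>. Using the upper bound for \<open>B + t\<close> and the lower
  bound for \<open>B\<close> at the same point \<open>x\<close>, it is at most \<open>exp (m * \<Lambda> t + o m)\<close>, where \<open>\<Lambda> t\<close> is the
  increment of \<open>ln (F x)\<close> when the field changes from \<open>B\<close> to \<open>B + t\<close> (\<open>graph_sum_ratio\<close>).
  Since \<open>\<Lambda>\<close> is differentiable at 0, Chernoff's inequality with small \<open>t\<close> of either sign gives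
  exponential concentration of \<open>S\<^sub>N / N\<close> around the number \<open>M = (1 - p) / 2 * \<Lambda>' 0\<close>
  (\<open>annealed_large_deviation\<close>). As \<open>S\<^sub>N / N\<close> is bounded, its mean tends to \<open>M\<close> as well
  (\<open>annealed_mean_tendsto\<close>), so \<open>M\<close> is the annealed magnetization.
\<close>

section \<open>Sums over pairings of half-edges\<close>

definition pairing_sum :: "('a set \<Rightarrow> real) \<Rightarrow> 'a set \<Rightarrow> real" where
  "pairing_sum w H = (\<Sum>P\<in>pairings H. \<Prod>e\<in>P. w e)"

lemma pairings_empty [simp]: "pairings {} = {{}}"
  by (auto simp: pairings_def partition_on_def)

text \<open>
  This makes the partner of a fixed half-edge a function of the pairing, so that a sum over
  pairings can be split according to that partner.
\<close>

lemma pairings_unique_partner: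
  assumes P: "P \<in> pairings H" and a: "a \<in> H"
  shows "\<exists>!b. b \<in> H - {a} \<and> {a, b} \<in> P"
proof -
  have part: "partition_on H P" and two: "\<And>e. e \<in> P \<Longrightarrow> card e = 2"
    using P by (auto simp: pairings_def)
  obtain e where e: "e \<in> P" "a \<in> e"
    using a partition_onD1[OF part] by auto
  from two[OF e(1)] obtain c d where cd: "e = {c, d}" "c \<noteq> d"
    by (auto simp: card_2_iff)
  define b where "b = (if a = c then d else c)"
  have b: "e = {a, b}" "b \<noteq> a" using cd e by (auto simp: b_def)
  have bH: "b \<in> H" using b e partition_onD1[OF part] by auto
  show ?thesis
  proof (rule ex1I[of _ b])
    show "b \<in> H - {a} \<and> {a, b} \<in> P" using b bH e by auto
  next
    fix b' assume b': "b' \<in> H - {a} \<and> {a, b'} \<in> P"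
    have "{a, b'} = {a, b}"
      using disjointD[OF partition_onD2[OF part], of "{a, b'}" "{a, b}"] b' b e by auto
    then show "b' = b" using b' by (auto simp: doubleton_eq_iff)
  qed
qed

lemma pairing_sum_rec:
  assumes fin: "finite H" and a: "a \<in> H"
  shows "pairing_sum w H = (\<Sum>b\<in>H - {a}. w {a, b} * pairing_sum w (H - {a, b}))"
proof -
  have un: "pairings H = (\<Union>b\<in>H - {a}. {P \<in> pairings H. {a, b} \<in> P})"
    using pairings_unique_partner[OF _ a] by blast
  have "pairing_sum w H =
      (\<Sum>b\<in>H - {a}. \<Sum>P\<in>{P \<in> pairings H. {a, b} \<in> P}. \<Prod>e\<in>P. w e)"
    unfolding pairing_sum_def
  proof (subst un, rule sum.UNION_disjoint)
    show "\<forall>b\<in>H - {a}. finite {P \<in> pairings H. {a, b} \<in> P}"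
      using finite_pairings[OF fin] by auto
    show "\<forall>b\<in>H - {a}. \<forall>c\<in>H - {a}. b \<noteq> c \<longrightarrow>
        {P \<in> pairings H. {a, b} \<in> P} \<inter> {P \<in> pairings H. {a, c} \<in> P} = {}"
      using pairings_unique_partner[OF _ a] by blast
  qed (use fin in simp)
  also have "\<dots> = (\<Sum>b\<in>H - {a}. w {a, b} * pairing_sum w (H - {a, b}))"
  proof (rule sum.cong[OF refl])
    fix b assume b: "b \<in> H - {a}"
    let ?K = "H - {a, b}"
    have new: "{a, b} \<notin> P" if "P \<in> pairings ?K" for P
      using that by (auto simp: pairings_def partition_on_def)
    have ins: "insert {a, b} P \<in> pairings H" if "P \<in> pairings ?K" for P
    proof -
      have "partition_on H (insert {a, b} P)"
        by (subst partition_on_insert)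
          (use that a b in \<open>auto simp: pairings_def partition_on_def disjnt_def\<close>)
      then show ?thesis using that b by (auto simp: pairings_def)
    qed
    have del: "P - {{a, b}} \<in> pairings ?K" if P: "P \<in> pairings H" "{a, b} \<in> P" for P
    proof -
      have "partition_on H (insert {a, b} (P - {{a, b}}))"
        using P by (simp add: pairings_def insert_absorb)
      moreover have "disjnt {a, b} (\<Union> (P - {{a, b}}))"
        using disjointD[of P "{a, b}"] P partition_onD2[of H P]
        by (fastforce simp: pairings_def disjnt_def)
      ultimately have "partition_on ?K (P - {{a, b}})"
        by (subst (asm) partition_on_insert) auto
      then show ?thesis using P by (auto simp: pairings_def)
    qed
    have "(\<Sum>P\<in>{P \<in> pairings H. {a, b} \<in> P}. \<Prod>e\<in>P. w e) =
        (\<Sum>P\<in>pairings ?K. \<Prod>e\<in>insert {a, b} P. w e)"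
      by (rule sum.reindex_bij_witness[where i = "insert {a, b}" and j = "\<lambda>P. P - {{a, b}}"])
        (use new ins del in \<open>auto simp: insert_absorb\<close>)
    also have "\<dots> = (\<Sum>P\<in>pairings ?K. w {a, b} * (\<Prod>e\<in>P. w e))"
    proof (rule sum.cong[OF refl])
      fix P assume P: "P \<in> pairings ?K"
      have "finite P"
        using P fin finite_elements[of ?K P] by (auto simp: pairings_def)
      then show "(\<Prod>e\<in>insert {a, b} P. w e) = w {a, b} * (\<Prod>e\<in>P. w e)"
        using new[OF P] by simp
    qed
    finally show "(\<Sum>P\<in>{P \<in> pairings H. {a, b} \<in> P}. \<Prod>e\<in>P. w e) =
        w {a, b} * pairing_sum w ?K"
      by (simp add: pairing_sum_def sum_distrib_left)
  qed
  finally show ?thesis .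
qed

text \<open>
  The Boltzmann sum over all pairings of \<open>h\<close> half-edges of spin \<open>1\<close> and \<open>k\<close> half-edges of spin
  \<open>-1\<close>, computed by choosing the partner of one half-edge at a time. For \<open>\<beta> \<ge> 0\<close> it is the
  mixed moment of order \<open>(h, k)\<close> of a centred Gaussian vector whose variances are \<open>exp \<beta>\<close> and
  whose covariance is \<open>exp (- \<beta>)\<close>.
\<close>

fun spin_pairing_sum :: "real \<Rightarrow> nat \<Rightarrow> nat \<Rightarrow> real" where
  "spin_pairing_sum \<beta> 0 0 = 1"
| "spin_pairing_sum \<beta> 0 (Suc k) = exp \<beta> * real k * spin_pairing_sum \<beta> 0 (k - 1)"
| "spin_pairing_sum \<beta> (Suc h) k = exp \<beta> * real h * spin_pairing_sum \<beta> (h - 1) k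
     + exp (- \<beta>) * real k * spin_pairing_sum \<beta> h (k - 1)"

lemma spin_pairing_sum_nonneg: "spin_pairing_sum \<beta> h k \<ge> 0"
  by (induction \<beta> h k rule: spin_pairing_sum.induct) auto

text \<open>
  All partners of \<open>a\<close> with the same spin contribute equally once the sums over the remaining
  half-edges depend on the spin of the removed partner only; \<open>P\<close> and \<open>Q\<close> are those two sums.
\<close>

lemma pairing_sum_split:
  fixes \<tau> :: "'a \<Rightarrow> real"
  assumes fin: "finite H" and a: "a \<in> H" and \<tau>: "\<And>c. c \<in> H \<Longrightarrow> \<tau> c = 1 \<or> \<tau> c = -1"
    and eq: "\<And>b. b \<in> H - {a} \<Longrightarrow> pairing_sum (\<lambda>e. exp (\<beta> * (\<Prod>c\<in>e. \<tau> c))) (H - {a, b}) =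
      (if \<tau> b = 1 then P else Q)"
  shows "pairing_sum (\<lambda>e. exp (\<beta> * (\<Prod>c\<in>e. \<tau> c))) H =
      exp (\<beta> * \<tau> a) * real (card {c \<in> H - {a}. \<tau> c = 1}) * P +
      exp (- \<beta> * \<tau> a) * real (card {c \<in> H - {a}. \<tau> c = -1}) * Q"
proof -
  have "pairing_sum (\<lambda>e. exp (\<beta> * (\<Prod>c\<in>e. \<tau> c))) H =
      (\<Sum>b\<in>H - {a}. exp (\<beta> * (\<tau> a * \<tau> b)) * (if \<tau> b = 1 then P else Q))"
    by (subst pairing_sum_rec[OF fin a], rule sum.cong) (auto simp: eq)
  also have "\<dots> = (\<Sum>b\<in>H - {a}. if \<tau> b = 1 then exp (\<beta> * \<tau> a) * P else exp (- \<beta> * \<tau> a) * Q)"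
  proof (rule sum.cong[OF refl])
    fix b assume "b \<in> H - {a}"
    then have "\<tau> b = 1 \<or> \<tau> b = -1" using \<tau> by blast
    then show "exp (\<beta> * (\<tau> a * \<tau> b)) * (if \<tau> b = 1 then P else Q) =
        (if \<tau> b = 1 then exp (\<beta> * \<tau> a) * P else exp (- \<beta> * \<tau> a) * Q)"
      by auto
  qed
  also have "\<dots> = exp (\<beta> * \<tau> a) * real (card {c \<in> H - {a}. \<tau> c = 1}) * P +
      exp (- \<beta> * \<tau> a) * real (card ((H - {a}) \<inter> - {b. \<tau> b = 1})) * Q"
    using fin by (subst sum.If_cases) (simp_all add: Int_def)
  also have "(H - {a}) \<inter> - {b. \<tau> b = 1} = {c \<in> H - {a}. \<tau> c = -1}"
    using \<tau> by auto
  finally show ?thesis .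
qed

lemma card_spin_remove:
  fixes \<tau> :: "'a \<Rightarrow> real"
  assumes "finite H" "a \<in> H"
  shows "card {c \<in> H - {a}. \<tau> c = s} = card {c \<in> H. \<tau> c = s} - (if \<tau> a = s then 1 else 0)"
proof -
  have "{c \<in> H - {a}. \<tau> c = s} = {c \<in> H. \<tau> c = s} - {a}" by auto
  then show ?thesis using assms by (auto simp: card_Diff_singleton_if)
qed

text \<open>
  Removing a matched pair lowers the two spin counts in a way that does not depend on which
  half-edges were removed, so by induction the pairing sum is a function of the counts alone.
\<close>

lemma pairing_sum_spins:
  fixes \<tau> :: "'a \<Rightarrow> real"
  assumes "finite H" and "\<And>c. c \<in> H \<Longrightarrow> \<tau> c = 1 \<or> \<tau> c = -1"
  shows "pairing_sum (\<lambda>e. exp (\<beta> * (\<Prod>c\<in>e. \<tau> c))) H =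
    spin_pairing_sum \<beta> (card {c \<in> H. \<tau> c = 1}) (card {c \<in> H. \<tau> c = -1})"
  using assms
proof (induction "card H" arbitrary: H rule: less_induct)
  case less
  let ?w = "\<lambda>e. exp (\<beta> * (\<Prod>c\<in>e. \<tau> c))"
  define h k where "h = card {c \<in> H. \<tau> c = 1}" and "k = card {c \<in> H. \<tau> c = -1}"
  have rem: "pairing_sum ?w (H - {a, b}) =
      (if \<tau> b = 1 then spin_pairing_sum \<beta> (h - (if \<tau> a = 1 then 1 else 0) - 1) (k - (if \<tau> a = -1 then 1 else 0))
       else spin_pairing_sum \<beta> (h - (if \<tau> a = 1 then 1 else 0)) (k - (if \<tau> a = -1 then 1 else 0) - 1))"
    if ab: "a \<in> H" "b \<in> H - {a}" for a b
  proof -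
    have "card {c \<in> H - {a} - {b}. \<tau> c = s} =
        card {c \<in> H. \<tau> c = s} - (if \<tau> a = s then 1 else 0) - (if \<tau> b = s then 1 else 0)" for s
      using ab less.prems by (subst card_spin_remove; simp only: card_spin_remove finite_Diff)
    moreover have "H - {a, b} = H - {a} - {b}" by auto
    ultimately have c: "card {c \<in> H - {a, b}. \<tau> c = s} =
        card {c \<in> H. \<tau> c = s} - (if \<tau> a = s then 1 else 0) - (if \<tau> b = s then 1 else 0)" for s
      by simp
    have "card (H - {a, b}) < card H"
      using ab less.prems by (intro psubset_card_mono) auto
    then have "pairing_sum ?w (H - {a, b}) = spin_pairing_sum \<beta>
        (card {c \<in> H - {a, b}. \<tau> c = 1}) (card {c \<in> H - {a, b}. \<tau> c = -1})"
      using less.prems by (intro less.hyps) auto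
    also have "\<dots> = (if \<tau> b = 1 then spin_pairing_sum \<beta> (h - (if \<tau> a = 1 then 1 else 0) - 1) (k - (if \<tau> a = -1 then 1 else 0))
       else spin_pairing_sum \<beta> (h - (if \<tau> a = 1 then 1 else 0)) (k - (if \<tau> a = -1 then 1 else 0) - 1))"
      unfolding c h_def[symmetric] k_def[symmetric] using less.prems(2)[of b] ab by auto
    finally show ?thesis .
  qed
  show ?case
  proof (cases "\<exists>a\<in>H. \<tau> a = 1")
    case True
    then obtain a where a: "a \<in> H" "\<tau> a = 1" by blast
    then have "h > 0" using less.prems by (auto simp: h_def card_gt_0_iff)
    then obtain h' where h': "h = Suc h'" using gr0_implies_Suc by blast
    have c: "card {c \<in> H - {a}. \<tau> c = 1} = h'" "card {c \<in> H - {a}. \<tau> c = -1} = k"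
      using h' a by (simp_all only: card_spin_remove[OF less.prems(1) a(1)] flip: h_def k_def) auto
    show ?thesis
      using pairing_sum_split[OF less.prems(1) a(1) less.prems(2) rem[OF a(1)]]
      unfolding h_def[symmetric] k_def[symmetric] c by (simp add: a h')
  next
    case no_plus: False
    then have "{c \<in> H. \<tau> c = 1} = {}" by auto
    then have h0: "h = 0" by (simp only: h_def card.empty)
    show ?thesis
    proof (cases "H = {}")
      case True
      then show ?thesis by (simp add: pairing_sum_def)
    next
      case False
      then obtain a where a: "a \<in> H" "\<tau> a = -1" using no_plus less.prems by blast
      then have "k > 0" using less.prems by (auto simp: k_def card_gt_0_iff)
      then obtain k' where k': "k = Suc k'" using gr0_implies_Suc by blast
      have c: "card {c \<in> H - {a}. \<tau> c = 1} = 0" "card {c \<in> H - {a}. \<tau> c = -1} = k'"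
        using h0 k' a by (simp_all only: card_spin_remove[OF less.prems(1) a(1)] flip: h_def k_def) auto
      show ?thesis
      using pairing_sum_split[OF less.prems(1) a(1) less.prems(2) rem[OF a(1)]]
      unfolding h_def[symmetric] k_def[symmetric] c by (simp add: a k' h0)
    qed
  qed
qed

text \<open>
  The defining equations always match a half-edge of spin \<open>1\<close> first. The value is symmetric in
  the two spins, so matching a half-edge of spin \<open>-1\<close> first must give the same; this is the
  second of the two integration by parts rules for Gaussian moments.
\<close>

lemma spin_pairing_sum_Suc_minus:
  "spin_pairing_sum \<beta> h (Suc k) = exp (- \<beta>) * real h * spin_pairing_sum \<beta> (h - 1) k
     + exp \<beta> * real k * spin_pairing_sum \<beta> h (k - 1)"
proof (induction "h + k" arbitrary: h k rule: less_induct)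
  case less
  show ?case
  proof (cases h)
    case 0
    then show ?thesis by simp
  next
    case (Suc h')
    have 1: "real h' * spin_pairing_sum \<beta> (h' - 1) (Suc k) =
       real h' * (exp (- \<beta>) * real (h' - 1) * spin_pairing_sum \<beta> (h' - 2) k
     + exp \<beta> * real k * spin_pairing_sum \<beta> (h' - 1) (k - 1))"
      using less[of "h' - 1" k] Suc by (cases h') auto
    have 2: "real k * spin_pairing_sum \<beta> h' k =
       real k * (exp (- \<beta>) * real h' * spin_pairing_sum \<beta> (h' - 1) (k - 1)
     + exp \<beta> * real (k - 1) * spin_pairing_sum \<beta> h' (k - 2))"
      using less[of h' "k - 1"] Suc by (cases k) auto
    have 3: "real h' * spin_pairing_sum \<beta> h' k =
      real h' * (exp \<beta> * real (h' - 1) * spin_pairing_sum \<beta> (h' - 2) k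
     + exp (- \<beta>) * real k * spin_pairing_sum \<beta> (h' - 1) (k - 1))"
      by (cases h') auto
    have 4: "real (Suc k) = 1 + real k" "real (Suc h') = 1 + real h'" by auto
    have 5: "k - 1 - 1 = k - 2" by simp
    show ?thesis
      unfolding Suc spin_pairing_sum.simps diff_Suc_1 4 5
      using arg_cong[OF 1, of "\<lambda>u. exp \<beta> * u"] arg_cong[OF 2, of "\<lambda>u. exp (- \<beta>) * u"]
        arg_cong[OF 3, of "\<lambda>u. exp (- \<beta>) * u"]
      by (simp add: algebra_simps)
  qed
qed

section \<open>Sums over spins as shift operators\<close>

text \<open>
  A function of the spin counts \<open>(h, k)\<close> is read as the family of moments \<open>E (X ^ h * Y ^ k)\<close>.
  Multiplying the underlying random variable by the linear form \<open>u * X + v * Y\<close>, or by the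
  quadratic form \<open>u * X\<^sup>2 + v * Y\<^sup>2\<close>, becomes one of the following two commuting shift
  operators. A vertex of degree 1 contributes such a linear form and a vertex of degree 2 such
  a quadratic form: both of its half-edges carry the same spin.
\<close>

definition leaf_op :: "real \<Rightarrow> real \<Rightarrow> (nat \<Rightarrow> nat \<Rightarrow> real) \<Rightarrow> nat \<Rightarrow> nat \<Rightarrow> real" where
  "leaf_op u v V = (\<lambda>h k. u * V (Suc h) k + v * V h (Suc k))"

definition inner_op :: "real \<Rightarrow> real \<Rightarrow> (nat \<Rightarrow> nat \<Rightarrow> real) \<Rightarrow> nat \<Rightarrow> nat \<Rightarrow> real" where
  "inner_op u v V = (\<lambda>h k. u * V (Suc (Suc h)) k + v * V h (Suc (Suc k)))"

lemma inner_op_leaf_op: "inner_op u v (leaf_op u' v' V) = leaf_op u' v' (inner_op u v V)"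
  by (simp add: inner_op_def leaf_op_def fun_eq_iff algebra_simps)

lemma inner_op_leaf_op_funpow:
  "inner_op u v ((leaf_op u' v' ^^ r) V) = (leaf_op u' v' ^^ r) (inner_op u v V)"
  by (induction r) (simp_all add: inner_op_leaf_op)

lemma sum_insert_PiE_spins:
  assumes "finite I" "i \<notin> I"
  shows "(\<Sum>\<sigma>\<in>insert i I \<rightarrow>\<^sub>E {-1, 1::real}. g \<sigma>) =
    (\<Sum>\<sigma>\<in>I \<rightarrow>\<^sub>E {-1, 1}. g (\<sigma>(i := 1)) + g (\<sigma>(i := -1)))"
proof -
  have "(\<Sum>\<sigma>\<in>insert i I \<rightarrow>\<^sub>E {-1, 1::real}. g \<sigma>) =
      (\<Sum>(s, \<sigma>)\<in>{-1, 1} \<times> (I \<rightarrow>\<^sub>E {-1, 1}). g (\<sigma>(i := s)))"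
    unfolding PiE_insert_eq using inj_combinator[OF assms(2), of "\<lambda>_. {-1, 1}"]
    by (subst sum.reindex) (auto intro!: sum.cong)
  also have "\<dots> = (\<Sum>s\<in>{-1, 1}. \<Sum>\<sigma>\<in>I \<rightarrow>\<^sub>E {-1, 1}. g (\<sigma>(i := s)))"
    by (simp add: sum.cartesian_product)
  finally show ?thesis by (simp add: sum.distrib add.commute)
qed

text \<open>
  The spin of each vertex is summed independently of the others, and the sum over one spin is
  precisely one application of the operator that belongs to its degree.
\<close>

lemma sum_spins_eq_operators:
  fixes d :: "nat \<Rightarrow> nat"
  assumes "finite I" "\<And>i. i \<in> I \<Longrightarrow> d i = 1 \<or> d i = 2"
  shows "(\<Sum>\<sigma>\<in>I \<rightarrow>\<^sub>E {-1, 1::real}. exp (B * (\<Sum>i\<in>I. \<sigma> i)) *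
      V (h + (\<Sum>i | i \<in> I \<and> \<sigma> i = 1. d i)) (k + (\<Sum>i | i \<in> I \<and> \<sigma> i = -1. d i))) =
    (leaf_op (exp B) (exp (- B)) ^^ card {i \<in> I. d i = 1})
      ((inner_op (exp B) (exp (- B)) ^^ card {i \<in> I. d i = 2}) V) h k"
  using assms
proof (induction I arbitrary: h k rule: finite_induct)
  case empty
  then show ?case by simp
next
  case (insert i I)
  have split: "(\<Sum>j | j \<in> insert i I \<and> (\<sigma>(i := s)) j = t. d j) =
      (if s = t then d i else 0) + (\<Sum>j | j \<in> I \<and> \<sigma> j = t. d j)" for \<sigma> :: "nat \<Rightarrow> real" and s t
  proof -
    have "{j \<in> insert i I. (\<sigma>(i := s)) j = t} =
        (if s = t then insert i {j \<in> I. \<sigma> j = t} else {j \<in> I. \<sigma> j = t})"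
      using insert.hyps by auto
    then show ?thesis using insert.hyps by auto
  qed
  have S: "(\<Sum>j\<in>insert i I. (\<sigma>(i := s)) j) = s + (\<Sum>j\<in>I. \<sigma> j)" for \<sigma> :: "nat \<Rightarrow> real" and s
    using insert.hyps by (subst sum.insert) (auto intro!: sum.cong)
  let ?f = "\<lambda>h k. (\<Sum>\<sigma>\<in>I \<rightarrow>\<^sub>E {-1, 1::real}. exp (B * (\<Sum>i\<in>I. \<sigma> i)) *
      V (h + (\<Sum>i | i \<in> I \<and> \<sigma> i = 1. d i)) (k + (\<Sum>i | i \<in> I \<and> \<sigma> i = -1. d i)))"
  let ?L = "leaf_op (exp B) (exp (- B))" and ?T = "inner_op (exp B) (exp (- B))"
  have "(\<Sum>\<sigma>\<in>insert i I \<rightarrow>\<^sub>E {-1, 1::real}. exp (B * (\<Sum>i\<in>insert i I. \<sigma> i)) *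
      V (h + (\<Sum>j | j \<in> insert i I \<and> \<sigma> j = 1. d j)) (k + (\<Sum>j | j \<in> insert i I \<and> \<sigma> j = -1. d j)))
    = exp B * ?f (h + d i) k + exp (- B) * ?f h (k + d i)"
  proof -
    define E where "E \<sigma> = exp (B * (\<Sum>i\<in>I. \<sigma> i))" for \<sigma> :: "nat \<Rightarrow> real"
    have E: "exp (B * (s + (\<Sum>i\<in>I. \<sigma> i))) = exp (B * s) * E \<sigma>" for s and \<sigma> :: "nat \<Rightarrow> real"
      by (simp only: E_def distrib_left exp_add)
    show ?thesis
      unfolding sum_insert_PiE_spins[OF insert.hyps] split S E E_def[symmetric]
      by (simp add: sum.distrib sum_distrib_left mult_ac add_ac)
  qed
  also have "\<dots> = (?L ^^ card {j \<in> insert i I. d j = 1})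
      ((?T ^^ card {j \<in> insert i I. d j = 2}) V) h k"
  proof -
    have card: "card {j \<in> insert i I. d j = c} =
        (if d i = c then Suc (card {j \<in> I. d j = c}) else card {j \<in> I. d j = c})" for c
    proof -
      have "{j \<in> insert i I. d j = c} =
          (if d i = c then insert i {j \<in> I. d j = c} else {j \<in> I. d j = c})" by auto
      then show ?thesis using insert.hyps by auto
    qed
    have IH: "?f h k = (?L ^^ card {i \<in> I. d i = 1}) ((?T ^^ card {i \<in> I. d i = 2}) V) h k" for h k
      using insert.prems by (intro insert.IH) auto
    have "d i = 1 \<or> d i = 2" using insert.prems by blast
    then show ?thesis
    proof
      assume "d i = 1"
      then show ?thesis unfolding IH card by (simp add: leaf_op_def)
    next
      assume 2: "d i = 2"
      have "(?L ^^ r) (?T W) = ?T ((?L ^^ r) W)" for r W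
        by (simp only: inner_op_leaf_op_funpow)
      then show ?thesis unfolding IH card using 2 by (simp add: inner_op_def)
    qed
  qed
  finally show ?case .
qed

section \<open>Wick's rule\<close>

text \<open>
  The annealed weights summed over all spins of \<open>r\<close> vertices of degree 1 and \<open>n\<close> vertices of
  degree 2, in presence of \<open>h\<close> and \<open>k\<close> further half-edges of fixed spin \<open>1\<close> and \<open>-1\<close>; still
  without division by the number of pairings.
\<close>

definition vertex_sum :: "real \<Rightarrow> real \<Rightarrow> nat \<Rightarrow> nat \<Rightarrow> nat \<Rightarrow> nat \<Rightarrow> real" where
  "vertex_sum \<beta> B r n = (leaf_op (exp B) (exp (- B)) ^^ r)
     ((inner_op (exp B) (exp (- B)) ^^ n) (spin_pairing_sum \<beta>))"

lemma vertex_sum_0 [simp]: "vertex_sum \<beta> B 0 0 = spin_pairing_sum \<beta>"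
  by (simp add: vertex_sum_def)

lemma vertex_sum_Suc: "vertex_sum \<beta> B (Suc r) n = leaf_op (exp B) (exp (- B)) (vertex_sum \<beta> B r n)"
  by (simp add: vertex_sum_def)

lemma vertex_sum_inner: "vertex_sum \<beta> B r (Suc n) = inner_op (exp B) (exp (- B)) (vertex_sum \<beta> B r n)"
  by (simp add: vertex_sum_def inner_op_leaf_op_funpow)

lemma vertex_sum_nonneg: "vertex_sum \<beta> B r n h k \<ge> 0"
proof -
  have "vertex_sum \<beta> B 0 n h k \<ge> 0" for h k
    by (induction n arbitrary: h k)
      (simp_all add: vertex_sum_inner spin_pairing_sum_nonneg inner_op_def)
  then show ?thesis
    by (induction r arbitrary: h k) (simp_all add: vertex_sum_Suc leaf_op_def)
qed

lemma spin_pairing_sum_Suc_plus: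
  "spin_pairing_sum \<beta> (Suc h) k = exp \<beta> * real h * spin_pairing_sum \<beta> (h - 1) k
     + exp (- \<beta>) * real k * spin_pairing_sum \<beta> h (k - 1)"
  by simp

text \<open>
  Wick's rule for an additional half-edge whose spin is weighted by the vector \<open>(u, v)\<close>. It is
  matched either with one of the loose half-edges, or with a vertex of degree 1, or with one
  of the \<open>2 * n\<close> half-edges at vertices of degree 2. In the last case the other half-edge of
  that vertex takes over the role of the additional one, with the vector transported along the
  edge and through the vertex. Formally this is the product rule for the derivative in
  direction \<open>(c, c')\<close>, proved by commuting one operator after the other past \<open>leaf_op u v\<close>.
\<close>

lemma leaf_op_vertex_sum:
  fixes u v \<beta> B :: real
  defines "c \<equiv> exp \<beta> * u + exp (- \<beta>) * v" and "c' \<equiv> exp (- \<beta>) * u + exp \<beta> * v"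
  shows "leaf_op u v (vertex_sum \<beta> B r n) h k =
    c * real h * vertex_sum \<beta> B r n (h - 1) k + c' * real k * vertex_sum \<beta> B r n h (k - 1)
    + real r * (exp B * c + exp (- B) * c') * vertex_sum \<beta> B (r - 1) n h k
    + 2 * real n * leaf_op (exp B * c) (exp (- B) * c') (vertex_sum \<beta> B r (n - 1)) h k"
proof (induction r arbitrary: h k)
  case 0
  show ?case
  proof (induction n arbitrary: h k)
    case 0
    show ?case
      unfolding vertex_sum_0 leaf_op_def spin_pairing_sum_Suc_plus spin_pairing_sum_Suc_minus
      by (simp add: c_def c'_def algebra_simps)
  next
    case (Suc n)
    let ?V = "vertex_sum \<beta> B 0 n" and ?V' = "vertex_sum \<beta> B 0 (n - 1)"
    have n: "real n * inner_op u' v' (vertex_sum \<beta> B 0 (n - 1)) h k = real n * vertex_sum \<beta> B 0 n h k"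
      if "u' = exp B" "v' = exp (- B)" for u' v' h k
      using that by (cases n) (simp_all add: vertex_sum_inner)
    have h: "real h * inner_op (exp B) (exp (- B)) ?V (h - 1) k =
        real h * (exp B * ?V (Suc h) k + exp (- B) * ?V (h - 1) (Suc (Suc k)))" for h k
      by (cases h) (simp_all add: inner_op_def)
    have k: "real k * inner_op (exp B) (exp (- B)) ?V h (k - 1) =
        real k * (exp B * ?V (Suc (Suc h)) (k - 1) + exp (- B) * ?V h (Suc k))" for h k
      by (cases k) (simp_all add: inner_op_def)
    have "leaf_op u v (vertex_sum \<beta> B 0 (Suc n)) h k =
       exp B * leaf_op u v ?V (Suc (Suc h)) k + exp (- B) * leaf_op u v ?V h (Suc (Suc k))"
      by (simp add: vertex_sum_inner leaf_op_def inner_op_def algebra_simps)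
    also have "\<dots> = c * (real h * inner_op (exp B) (exp (- B)) ?V (h - 1) k)
        + c' * (real k * inner_op (exp B) (exp (- B)) ?V h (k - 1))
        + 2 * leaf_op (exp B * c) (exp (- B) * c') ?V h k
        + 2 * leaf_op (exp B * c) (exp (- B) * c')
            (\<lambda>h k. real n * inner_op (exp B) (exp (- B)) ?V' h k) h k"
      unfolding Suc h k by (simp add: inner_op_def leaf_op_def algebra_simps)
    also have "\<dots> = c * real h * inner_op (exp B) (exp (- B)) ?V (h - 1) k
        + c' * real k * inner_op (exp B) (exp (- B)) ?V h (k - 1)
        + 2 * real (Suc n) * leaf_op (exp B * c) (exp (- B) * c') ?V h k"
      unfolding n[OF refl refl] by (simp add: leaf_op_def algebra_simps)
    finally show ?case by (simp add: vertex_sum_inner)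
  qed
next
  case (Suc r)
  let ?V = "vertex_sum \<beta> B r n" and ?V' = "vertex_sum \<beta> B r (n - 1)"
  let ?L = "leaf_op (exp B) (exp (- B))"
  have r: "real r * ?L (vertex_sum \<beta> B (r - 1) n) h k = real r * ?V h k" for h k
    by (cases r) (simp_all add: vertex_sum_Suc)
  have h: "real h * ?L ?V (h - 1) k =
      real h * (exp B * ?V h k + exp (- B) * ?V (h - 1) (Suc k))" for h k
    by (cases h) (simp_all add: leaf_op_def)
  have k: "real k * ?L ?V h (k - 1) =
      real k * (exp B * ?V (Suc h) (k - 1) + exp (- B) * ?V h k)" for h k
    by (cases k) (simp_all add: leaf_op_def)
  have "leaf_op u v (vertex_sum \<beta> B (Suc r) n) h k =
     exp B * leaf_op u v ?V (Suc h) k + exp (- B) * leaf_op u v ?V h (Suc k)"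
    by (simp add: vertex_sum_Suc leaf_op_def algebra_simps)
  also have "\<dots> = c * (real h * ?L ?V (h - 1) k) + c' * (real k * ?L ?V h (k - 1))
      + (exp B * c + exp (- B) * c') * ?V h k
      + (exp B * c + exp (- B) * c') * (real r * ?L (vertex_sum \<beta> B (r - 1) n) h k)
      + 2 * real n * leaf_op (exp B * c) (exp (- B) * c') (?L ?V') h k"
    unfolding Suc h k by (simp add: leaf_op_def algebra_simps)
  also have "\<dots> = c * real h * ?L ?V (h - 1) k + c' * real k * ?L ?V h (k - 1)
      + real (Suc r) * (exp B * c + exp (- B) * c') * ?V h k
      + 2 * real n * leaf_op (exp B * c) (exp (- B) * c') (?L ?V') h k"
    unfolding r by (simp add: algebra_simps)
  finally show ?case by (simp add: vertex_sum_Suc)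
qed

section \<open>Decomposition into paths and cycles\<close>

text \<open>
  The vector that arrives when a leaf is transported through \<open>k\<close> vertices of degree 2. With
  the edge matrix \<open>C\<close>, which has \<open>exp \<beta>\<close> on and \<open>exp (- \<beta>)\<close> off the diagonal, and with
  \<open>D = diag (exp B, exp (- B))\<close>, it is \<open>(D C) ^ k\<close> applied to the diagonal of \<open>D\<close>.
\<close>

fun transfer :: "real \<Rightarrow> real \<Rightarrow> nat \<Rightarrow> real \<times> real" where
  "transfer \<beta> B 0 = (exp B, exp (- B))"
| "transfer \<beta> B (Suc k) = (let (u, v) = transfer \<beta> B k in
     (exp B * (exp \<beta> * u + exp (- \<beta>) * v), exp (- B) * (exp (- \<beta>) * u + exp \<beta> * v)))"

text \<open>
  The Ising partition function of a path with \<open>k\<close> inner vertices and two end vertices; hence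
  the shift by one in the index.
\<close>

definition line_weight :: "real \<Rightarrow> real \<Rightarrow> nat \<Rightarrow> real" where
  "line_weight \<beta> B k = fst (transfer \<beta> B (Suc k)) + snd (transfer \<beta> B (Suc k))"

text \<open>
  The \<open>n\<close> vertices of degree 2 can be permuted and each of them can be flipped; dividing by
  the order of this symmetry group turns the recursion below into a convolution.
\<close>

definition normalized_sum :: "real \<Rightarrow> real \<Rightarrow> nat \<Rightarrow> nat \<Rightarrow> real" where
  "normalized_sum \<beta> B r n = vertex_sum \<beta> B r n 0 0 / (2 ^ n * fact n)"

text \<open>
  Iterating Wick's rule follows the path that starts at one leaf, until it ends at another one
  after \<open>j\<close> further vertices of degree 2.
\<close>

lemma leaf_op_transfer_expand:
  "leaf_op (fst (transfer \<beta> B k)) (snd (transfer \<beta> B k)) (vertex_sum \<beta> B r n) 0 0 / (2 ^ n * fact n)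
    = real r * (\<Sum>j\<le>n. line_weight \<beta> B (k + j) * normalized_sum \<beta> B (r - 1) (n - j))"
proof (induction n arbitrary: k)
  case 0
  show ?case
    by (subst leaf_op_vertex_sum) (simp add: normalized_sum_def line_weight_def split_beta)
next
  case (Suc n)
  have T: "transfer \<beta> B (Suc k) =
      (exp B * (exp \<beta> * fst (transfer \<beta> B k) + exp (- \<beta>) * snd (transfer \<beta> B k)),
       exp (- B) * (exp (- \<beta>) * fst (transfer \<beta> B k) + exp \<beta> * snd (transfer \<beta> B k)))"
    by (simp add: split_beta)
  have "leaf_op (fst (transfer \<beta> B k)) (snd (transfer \<beta> B k)) (vertex_sum \<beta> B r (Suc n)) 0 0 =
      real r * line_weight \<beta> B k * vertex_sum \<beta> B (r - 1) (Suc n) 0 0 +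
      2 * real (Suc n) * leaf_op (fst (transfer \<beta> B (Suc k))) (snd (transfer \<beta> B (Suc k)))
        (vertex_sum \<beta> B r n) 0 0"
    unfolding T line_weight_def by (subst leaf_op_vertex_sum) simp
  moreover have D: "(2 :: real) ^ Suc n * fact (Suc n) = 2 * real (Suc n) * (2 ^ n * fact n)"
    by (simp add: algebra_simps)
  ultimately have "leaf_op (fst (transfer \<beta> B k)) (snd (transfer \<beta> B k)) (vertex_sum \<beta> B r (Suc n)) 0 0
      / (2 ^ Suc n * fact (Suc n)) = real r * line_weight \<beta> B k * normalized_sum \<beta> B (r - 1) (Suc n) +
      leaf_op (fst (transfer \<beta> B (Suc k))) (snd (transfer \<beta> B (Suc k)))
        (vertex_sum \<beta> B r n) 0 0 / (2 ^ n * fact n)"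
    unfolding D normalized_sum_def by (simp only: add_divide_distrib) (simp del: transfer.simps of_nat_Suc)
  also have "\<dots> = real r * (\<Sum>j\<le>Suc n. line_weight \<beta> B (k + j) * normalized_sum \<beta> B (r - 1) (Suc n - j))"
    unfolding Suc by (simp add: sum.atMost_Suc_shift distrib_left mult.assoc del: sum.atMost_Suc)
  finally show ?case .
qed

lemma normalized_sum_Suc:
  "normalized_sum \<beta> B (Suc r) n =
     real r * (\<Sum>j\<le>n. line_weight \<beta> B j * normalized_sum \<beta> B (r - 1) (n - j))"
  using leaf_op_transfer_expand[of \<beta> B 0 r n] by (simp add: normalized_sum_def vertex_sum_Suc)

text \<open>
  The product is the number of ways to pair up the \<open>2 * m\<close> leaves as the ends of paths.
\<close>

definition graph_sum :: "real \<Rightarrow> real \<Rightarrow> nat \<Rightarrow> nat \<Rightarrow> real" where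
  "graph_sum \<beta> B m n = normalized_sum \<beta> B (2 * m) n / (\<Prod>i<m. real (2 * i + 1))"

lemma graph_sum_0_0 [simp]: "graph_sum \<beta> B 0 0 = 1"
  by (simp add: graph_sum_def normalized_sum_def)

lemma graph_sum_nonneg: "graph_sum \<beta> B m n \<ge> 0"
  unfolding graph_sum_def normalized_sum_def
  by (intro divide_nonneg_nonneg vertex_sum_nonneg prod_nonneg) auto

text \<open>
  A configuration model with these degrees is a disjoint union of paths and cycles. Splitting
  off the path through one leaf shows that \<open>graph_sum \<beta> B m n\<close> is the coefficient of \<open>z ^ n\<close>
  in \<open>g z * F z ^ m\<close>, where \<open>F\<close> generates the weights of paths and \<open>g\<close> those of unions of
  cycles.
\<close>

lemma graph_sum_Suc:
  "graph_sum \<beta> B (Suc m) n = (\<Sum>j\<le>n. line_weight \<beta> B j * graph_sum \<beta> B m (n - j))"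
proof -
  have "normalized_sum \<beta> B (2 * Suc m) n =
      real (2 * m + 1) * (\<Sum>j\<le>n. line_weight \<beta> B j * normalized_sum \<beta> B (2 * m) (n - j))"
    using normalized_sum_Suc[of \<beta> B "2 * m + 1" n] by simp
  then show ?thesis
    unfolding graph_sum_def by (simp add: sum_divide_distrib)
qed

text \<open>
  Replacing a vertex of degree 2 by two leaves with independent spins adds only nonnegative
  terms and changes the others by a bounded factor.
\<close>

lemma inner_op_le_leaf_op_leaf_op:
  assumes V: "\<And>h k. V h k \<ge> 0"
  shows "inner_op (exp B) (exp (- B)) V h k \<le>
    exp \<bar>B\<bar> * leaf_op (exp B) (exp (- B)) (leaf_op (exp B) (exp (- B)) V) h k"
proof -
  have 1: "exp B \<le> exp \<bar>B\<bar> * (exp B * exp B)" "exp (- B) \<le> exp \<bar>B\<bar> * (exp (- B) * exp (- B))"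
    by (auto simp flip: exp_add)
  have "inner_op (exp B) (exp (- B)) V h k \<le> exp \<bar>B\<bar> * (exp B * exp B) * V (Suc (Suc h)) k
     + exp \<bar>B\<bar> * (exp (- B) * exp (- B)) * V h (Suc (Suc k))"
    unfolding inner_op_def by (intro add_mono mult_right_mono 1 V)
  also have "\<dots> \<le> \<dots> + exp \<bar>B\<bar> * (2 * exp B * exp (- B) * V (Suc h) (Suc k))"
    using V by simp
  also have "\<dots> = exp \<bar>B\<bar> * leaf_op (exp B) (exp (- B)) (leaf_op (exp B) (exp (- B)) V) h k"
    by (simp add: leaf_op_def algebra_simps)
  finally show ?thesis .
qed

text \<open>
  Cutting a cycle open at a vertex yields a path, so unions of cycles are controlled by path
  weights. This suffices to see that \<open>g\<close> converges wherever \<open>F\<close> does.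
\<close>

lemma graph_sum_cycles_le:
  "2 * real (Suc n) * graph_sum \<beta> B 0 (Suc n) \<le>
     exp \<bar>B\<bar> * (\<Sum>j\<le>n. line_weight \<beta> B j * graph_sum \<beta> B 0 (n - j))"
proof -
  have "vertex_sum \<beta> B 0 (Suc n) 0 0 \<le> exp \<bar>B\<bar> * vertex_sum \<beta> B (Suc (Suc 0)) n 0 0"
    unfolding vertex_sum_inner vertex_sum_Suc
    by (rule inner_op_le_leaf_op_leaf_op) (rule vertex_sum_nonneg)
  then have "vertex_sum \<beta> B 0 (Suc n) 0 0 / (2 ^ n * fact n) \<le>
      exp \<bar>B\<bar> * vertex_sum \<beta> B (Suc (Suc 0)) n 0 0 / (2 ^ n * fact n)"
    by (intro divide_right_mono) auto
  also have "vertex_sum \<beta> B 0 (Suc n) 0 0 / (2 ^ n * fact n) =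
      2 * real (Suc n) * graph_sum \<beta> B 0 (Suc n)"
    by (simp add: graph_sum_def normalized_sum_def del: of_nat_Suc)
  also have "exp \<bar>B\<bar> * vertex_sum \<beta> B (Suc (Suc 0)) n 0 0 / (2 ^ n * fact n) =
      exp \<bar>B\<bar> * graph_sum \<beta> B (Suc 0) n"
    by (simp add: graph_sum_def normalized_sum_def numeral_2_eq_2)
  finally show ?thesis by (simp only: graph_sum_Suc)
qed

section \<open>Coefficients of large powers of a power series\<close>

lemma fps_power_Suc_nth:
  fixes f :: "nat \<Rightarrow> real"
  shows "fps_nth (Abs_fps f ^ Suc m) n = (\<Sum>j\<le>n. f j * fps_nth (Abs_fps f ^ m) (n - j))"
  by (simp add: fps_mult_nth atLeast0AtMost)

lemma fps_power_nth_nonneg: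
  fixes f :: "nat \<Rightarrow> real"
  assumes "\<And>k. f k \<ge> 0"
  shows "fps_nth (Abs_fps f ^ m) n \<ge> 0"
proof (induction m arbitrary: n)
  case (Suc m)
  then show ?case unfolding fps_power_Suc_nth using assms by (intro sum_nonneg mult_nonneg_nonneg)
qed simp

lemma fps_power_sums:
  fixes f :: "nat \<Rightarrow> real"
  assumes f: "\<And>k. f k \<ge> 0" and z: "z \<ge> 0" and F: "(\<lambda>k. f k * z ^ k) sums F"
  shows "(\<lambda>n. fps_nth (Abs_fps f ^ m) n * z ^ n) sums F ^ m"
proof (induction m)
  case 0
  have "(\<lambda>n. if n = 0 then (1::real) else 0) sums 1" by (rule sums_single)
  then show ?case by (simp add: if_distrib if_distribR cong: if_cong)
next
  case (Suc m)
  have "(\<lambda>n. \<Sum>j\<le>n. (f j * z ^ j) * (fps_nth (Abs_fps f ^ m) (n - j) * z ^ (n - j))) sums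
      ((\<Sum>k. f k * z ^ k) * (\<Sum>k. fps_nth (Abs_fps f ^ m) k * z ^ k))"
    using F Suc f z fps_power_nth_nonneg[OF f]
    by (intro Cauchy_product_sums) (auto simp: sums_iff abs_mult)
  moreover have "(\<Sum>j\<le>n. (f j * z ^ j) * (fps_nth (Abs_fps f ^ m) (n - j) * z ^ (n - j))) =
      fps_nth (Abs_fps f ^ Suc m) n * z ^ n" for n
    unfolding fps_power_Suc_nth sum_distrib_right
    by (rule sum.cong) (simp_all add: mult_ac flip: power_add)
  ultimately show ?case using F Suc by (simp add: sums_iff)
qed

lemma fps_power_nth_Suc_ge:
  fixes f :: "nat \<Rightarrow> real"
  assumes f: "\<And>k. f k \<ge> 0" and c: "\<And>k. f (Suc k) \<ge> c * f k" and m: "m > 0"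
  shows "fps_nth (Abs_fps f ^ m) (Suc n) \<ge> c * fps_nth (Abs_fps f ^ m) n"
proof -
  obtain m' where m': "m = Suc m'" using m gr0_implies_Suc by blast
  have "c * fps_nth (Abs_fps f ^ m) n = (\<Sum>j\<le>n. (c * f j) * fps_nth (Abs_fps f ^ m') (n - j))"
    unfolding m' fps_power_Suc_nth by (simp add: sum_distrib_left mult_ac)
  also have "\<dots> \<le> (\<Sum>j\<le>n. f (Suc j) * fps_nth (Abs_fps f ^ m') (n - j))"
    by (intro sum_mono mult_right_mono c fps_power_nth_nonneg f)
  also have "\<dots> \<le> f 0 * fps_nth (Abs_fps f ^ m') (Suc n) + \<dots>"
    using f fps_power_nth_nonneg[OF f] by simp
  also have "\<dots> = fps_nth (Abs_fps f ^ m) (Suc n)"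
    unfolding m' fps_power_Suc_nth by (simp add: sum.atMost_Suc_shift del: sum.atMost_Suc)
  finally show ?thesis .
qed

lemma fps_power_nth_add_ge:
  fixes f :: "nat \<Rightarrow> real"
  assumes f: "\<And>k. f k \<ge> 0" and c: "\<And>k. f (Suc k) \<ge> c * f k" and m: "m > 0" and c0: "c \<ge> 0"
  shows "fps_nth (Abs_fps f ^ m) (n + k) \<ge> c ^ k * fps_nth (Abs_fps f ^ m) n"
proof (induction k)
  case (Suc k)
  have "c ^ Suc k * fps_nth (Abs_fps f ^ m) n \<le> c * fps_nth (Abs_fps f ^ m) (n + k)"
    using mult_left_mono[OF Suc c0] by (simp add: mult_ac)
  also have "\<dots> \<le> fps_nth (Abs_fps f ^ m) (n + Suc k)"
    using fps_power_nth_Suc_ge[of f c m "n + k", OF f c m] by simp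
  finally show ?case .
qed simp

text \<open>
  Multiply the coefficients of the power by \<open>z ^ k\<close>; they then sum to \<open>F ^ m\<close>. The mass beyond
  index \<open>n\<close> is estimated by Chernoff's inequality with the larger argument \<open>w1\<close>, the mass
  before index \<open>n - l\<close> with the smaller argument \<open>w2\<close>. What remains sits in a window of length
  \<open>l\<close> to the left of \<open>n\<close>, and the growth condition transports it to the index \<open>n\<close> at a cost of
  at most \<open>1 / q\<close> per step.
\<close>

lemma fps_power_coefficient_ge:
  fixes f :: "nat \<Rightarrow> real"
  assumes f: "\<And>k. f k \<ge> 0" and c: "\<And>k. f (Suc k) \<ge> c * f k" "c > 0" and m: "m > 0"
    and w: "0 < w2" "w2 < z" "z < w1"
    and F: "(\<lambda>k. f k * z ^ k) sums F" "(\<lambda>k. f k * w1 ^ k) sums F1" "(\<lambda>k. f k * w2 ^ k) sums F2"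
    and q: "0 < q" "q \<le> 1" "q \<le> c * z" and l: "l \<le> n"
  shows "F ^ m \<le> real (Suc l) * (fps_nth (Abs_fps f ^ m) n * z ^ n) / q ^ l
     + (z / w1) ^ n * F1 ^ m + (z / w2) ^ (n - l) * F2 ^ m"
proof -
  define b where "b = fps_nth (Abs_fps f ^ m)"
  have b0: "b k \<ge> 0" for k unfolding b_def by (rule fps_power_nth_nonneg[OF f])
  have bF: "(\<lambda>n. b n * z ^ n) sums F ^ m" "(\<lambda>n. b n * w1 ^ n) sums F1 ^ m"
      "(\<lambda>n. b n * w2 ^ n) sums F2 ^ m"
    unfolding b_def using w by (auto intro!: fps_power_sums f F)
  have win: "b k * z ^ k \<le> b n * z ^ n / q ^ l" if k: "k \<in> {n - l..n}" for k
  proof -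
    define i where "i = n - k"
    have i: "n = k + i" "i \<le> l" using k l by (auto simp: i_def)
    have "q ^ l * (b k * z ^ k) \<le> q ^ i * (b k * z ^ k)"
      using q i b0 w by (intro mult_right_mono power_decreasing) auto
    also have "\<dots> \<le> (c * z) ^ i * (b k * z ^ k)"
      using q b0 w by (intro mult_right_mono power_mono) auto
    also have "\<dots> = (c ^ i * b k) * z ^ n"
      by (simp add: i power_add power_mult_distrib)
    also have "\<dots> \<le> b n * z ^ n"
      unfolding i b_def using w c by (intro mult_right_mono fps_power_nth_add_ge f m) auto
    finally show ?thesis using q by (simp add: field_simps)
  qed
  have term_le: "b k * z ^ k \<le> (if k \<in> {n - l..n} then b n * z ^ n / q ^ l else 0)
      + (z / w1) ^ n * (b k * w1 ^ k) + (z / w2) ^ (n - l) * (b k * w2 ^ k)" for k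
  proof -
    have p: "0 \<le> (z / w1) ^ n * (b k * w1 ^ k)" "0 \<le> (z / w2) ^ (n - l) * (b k * w2 ^ k)"
      using b0 w by auto
    consider "k \<in> {n - l..n}" | "k > n" | "k < n - l" by force
    then show ?thesis
    proof cases
      case 1
      then show ?thesis using win[OF 1] p by simp
    next
      case 2
      have "b k * z ^ k = (z / w1) ^ k * (b k * w1 ^ k)"
        using w by (simp add: power_divide)
      also have "\<dots> \<le> (z / w1) ^ n * (b k * w1 ^ k)"
        using 2 w b0 by (intro mult_right_mono power_decreasing) auto
      finally show ?thesis using p 2 by simp
    next
      case 3
      have "b k * z ^ k = (z / w2) ^ k * (b k * w2 ^ k)"
        using w by (simp add: power_divide)
      also have "\<dots> \<le> (z / w2) ^ (n - l) * (b k * w2 ^ k)"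
        using 3 w b0 by (intro mult_right_mono power_increasing) auto
      finally show ?thesis using p 3 by simp
    qed
  qed
  have "(\<lambda>k. (if k \<in> {n - l..n} then b n * z ^ n / q ^ l else 0)
      + (z / w1) ^ n * (b k * w1 ^ k) + (z / w2) ^ (n - l) * (b k * w2 ^ k)) sums
      ((\<Sum>k\<in>{n - l..n}. b n * z ^ n / q ^ l) + (z / w1) ^ n * F1 ^ m + (z / w2) ^ (n - l) * F2 ^ m)"
    by (intro sums_add sums_mult bF sums_If_finite_set) simp
  from sums_le[OF term_le bF(1) this] show ?thesis
    using l by (simp add: b_def)
qed

text \<open>
  If \<open>n / m\<close> tends to \<open>r\<close>, then \<open>u ^ n * v ^ m\<close> has exponential rate \<open>r * ln u + ln v\<close> in \<open>m\<close>.
\<close>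

lemma eventually_powers_le:
  fixes m n :: "nat \<Rightarrow> nat"
  assumes m: "filterlim m at_top G" and n: "((\<lambda>N. real (n N) / real (m N)) \<longlongrightarrow> r) G"
    and uv: "u > 0" "v > 0" "r * ln u + ln v < 0" and e: "e > 0"
  shows "\<forall>\<^sub>F N in G. u ^ n N * v ^ m N \<le> e"
proof -
  define s where "s = r * ln u + ln v"
  define k where "k = - s / 2"
  have s: "s < 0" using uv by (simp add: s_def)
  have k: "k > 0" using s by (simp add: k_def)
  have "((\<lambda>N. real (n N) / real (m N) * ln u + ln v) \<longlongrightarrow> s) G"
    unfolding s_def by (intro tendsto_intros n)
  moreover have "s < - k" using s by (simp add: k_def)
  ultimately have 1: "\<forall>\<^sub>F N in G. real (n N) / real (m N) * ln u + ln v < - k"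
    by (rule order_tendstoD)
  have "filterlim (\<lambda>N. real (m N)) at_top G"
    by (rule filterlim_compose[OF filterlim_real_sequentially m])
  then have 2: "\<forall>\<^sub>F N in G. real (m N) > max 0 (- ln e / k)"
    by (rule eventually_compose_filterlim[OF eventually_gt_at_top])
  from 1 2 show ?thesis
  proof eventually_elim
    case (elim N)
    then have m0: "real (m N) > 0" and mk: "real (m N) * k > - ln e"
      using k by (auto simp: field_simps)
    have "real (n N) * ln u + real (m N) * ln v = real (m N) * (real (n N) / real (m N) * ln u + ln v)"
      using m0 by (simp add: field_simps)
    also have "\<dots> \<le> real (m N) * (- k)"
      using elim m0 by (intro mult_left_mono) auto
    also have "\<dots> \<le> ln e" using mk by simp
    finally have "exp (real (n N) * ln u + real (m N) * ln v) \<le> exp (ln e)" by simp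
    then show ?case using uv e by (simp add: exp_add exp_of_nat_mult)
  qed
qed

text \<open>
  The lower bound in the saddle point estimate: up to a subexponential factor, the coefficient
  of index \<open>n\<close>, with \<open>n / m\<close> tending to \<open>r\<close>, is at least \<open>F x ^ m / x ^ n\<close> at the saddle point
  \<open>x\<close>.

  Under the law with weights \<open>f k * z ^ k / F z\<close> the mean is \<open>z * F' z / F z\<close>. At an argument
  \<open>z\<close> slightly below \<open>x\<close> this mean lies strictly between \<open>r - \<delta>\<close> and \<open>r\<close>, so that a sum of \<open>m\<close>
  independent copies falls, for large \<open>m\<close> with probability at least one half, into the window
  of width \<open>\<delta> * m\<close> to the left of \<open>n\<close>. Aiming below \<open>r\<close> matters, because the growth condition
  compares coefficients in one direction only. Finally \<open>\<delta>\<close> is small and \<open>z\<close> is close to \<open>x\<close>.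
\<close>

lemma fps_power_coefficient_asymp_ge:
  fixes f :: "nat \<Rightarrow> real" and F F' :: "real \<Rightarrow> real" and m n :: "nat \<Rightarrow> nat"
  assumes f: "\<And>k. f k \<ge> 0" and c: "\<And>k. f (Suc k) \<ge> c * f k" "c > 0"
    and x: "0 < x" "x < R"
    and F: "\<And>z. 0 < z \<Longrightarrow> z < R \<Longrightarrow> (\<lambda>k. f k * z ^ k) sums F z"
    and Fpos: "\<And>z. 0 < z \<Longrightarrow> z < R \<Longrightarrow> F z > 0"
    and F': "\<And>z. 0 < z \<Longrightarrow> z < R \<Longrightarrow> (F has_real_derivative F' z) (at z)"
    and cont: "isCont F' x"
    and crit: "x * F' x / F x = r" and below: "\<And>z. 0 < z \<Longrightarrow> z < x \<Longrightarrow> z * F' z / F z < r"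
    and m: "filterlim m at_top G" and n: "((\<lambda>N. real (n N) / real (m N)) \<longlongrightarrow> r) G" and r: "r > 0"
    and e: "e > 0"
  shows "\<forall>\<^sub>F N in G. exp (real (m N) * (ln (F x) - r * ln x - e)) \<le>
    fps_nth (Abs_fps f ^ m N) (n N)"
proof -
  \<comment> \<open>Valid as step cost for every \<open>z > x / 2\<close>.\<close>
  define q where "q = min 1 (c * (x / 2))"
  have q: "0 < q" "q \<le> 1" using x c by (auto simp: q_def)
  have lq: "ln (2 / q) > 0" using q by simp
  \<comment> \<open>The factor 2 in \<open>2 / q\<close> will absorb the number of indices in the window, as \<open>Suc l
    \<le> 2 ^ l\<close>.\<close>
  define \<delta> where "\<delta> = min (r / 2) (e / (4 * ln (2 / q)))"
  have \<delta>: "0 < \<delta>" "\<delta> < r" using r e lq by (auto simp: \<delta>_def)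
  have "\<delta> * ln (2 / q) \<le> e / (4 * ln (2 / q)) * ln (2 / q)"
    using lq by (intro mult_right_mono) (auto simp: \<delta>_def)
  then have \<delta>e: "\<delta> * ln (2 / q) \<le> e / 4" using lq by simp
  \<comment> \<open>Logarithm of the Chernoff bound per copy for the value \<open>s\<close>; the sign of its
    derivative tells on which side of \<open>s\<close> the mean lies.\<close>
  define H where "H s z = ln (F z) - s * ln z" for s z
  have H': "(H s has_real_derivative (z * F' z / F z - s) / z) (at z)" if "0 < z" "z < R" for s z
    unfolding H_def [abs_def] using that Fpos[OF that]
    by (auto intro!: derivative_eq_intros F' simp: field_simps)
  have contF: "isCont F x" using F'[OF x] by (rule DERIV_isCont)
  have "((\<lambda>z. z * F' z / F z) \<longlongrightarrow> x * F' x / F x) (at_left x)"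
    using cont contF Fpos[OF x]
    by (intro tendsto_intros) (auto simp: isCont_def filterlim_at_split)
  moreover have "x * F' x / F x > r - \<delta>" using crit \<delta> by simp
  ultimately have 1: "\<forall>\<^sub>F z in at_left x. r - \<delta> < z * F' z / F z"
    by (rule order_tendstoD)
  have "(H r \<longlongrightarrow> H r x) (at_left x)"
    using DERIV_isCont[OF H'[OF x]] by (auto simp: isCont_def filterlim_at_split)
  then have 2: "\<forall>\<^sub>F z in at_left x. H r x - e / 4 < H r z"
    by (rule order_tendstoD) (use e in simp)
  have 3: "\<forall>\<^sub>F z in at_left x. z \<in> {x / 2<..<x}"
    by (rule eventually_at_leftI[of "x / 2"]) (use x in auto)
  obtain z where z: "r - \<delta> < z * F' z / F z" "H r x - e / 4 < H r z" "x / 2 < z" "z < x"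
    using eventually_happens[OF eventually_conj[OF 1 eventually_conj[OF 2 3]]] by auto
  have z0: "0 < z" "z < R" using z x by auto
  have qz: "q \<le> c * z"
  proof -
    have "q \<le> c * (x / 2)" by (simp add: q_def)
    also have "\<dots> \<le> c * z" using z c by (intro mult_left_mono) auto
    finally show ?thesis .
  qed
  have "(z * F' z / F z - r) / z < 0" using below[of z] z z0 by (simp add: divide_neg_pos)
  from DERIV_neg_dec_right[OF H'[OF z0] this] obtain d1 where d1: "d1 > 0"
    "\<And>h. h > 0 \<Longrightarrow> h < d1 \<Longrightarrow> H r (z + h) < H r z" by blast
  define w1 where "w1 = z + min (d1 / 2) ((R - z) / 2)"
  have w1: "z < w1" "w1 < R" "H r w1 < H r z"
    using d1(1) z0 unfolding w1_def by (simp add: min_def field_simps, simp add: min_def field_simps,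
      intro d1(2)) auto
  have "(z * F' z / F z - (r - \<delta>)) / z > 0" using z z0 by simp
  from DERIV_pos_inc_left[OF H'[OF z0] this] obtain d2 where d2: "d2 > 0"
    "\<And>h. h > 0 \<Longrightarrow> h < d2 \<Longrightarrow> H (r - \<delta>) (z - h) < H (r - \<delta>) z" by blast
  define w2 where "w2 = z - min (d2 / 2) (z / 2)"
  have w2: "0 < w2" "w2 < z" "H (r - \<delta>) w2 < H (r - \<delta>) z"
    using d2(1) z0 unfolding w2_def by (simp add: min_def field_simps, simp add: min_def field_simps,
      intro d2(2)) auto
  have pos: "F z > 0" "F w1 > 0" "F w2 > 0" using w1 w2 z0 by (auto intro!: Fpos)
  define l where "l N = nat \<lfloor>\<delta> * real (m N)\<rfloor>" for N
  have mr: "filterlim (\<lambda>N. real (m N)) at_top G"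
    by (rule filterlim_compose[OF filterlim_real_sequentially m])
  have l_lim: "((\<lambda>N. real (l N) / real (m N)) \<longlongrightarrow> \<delta>) G"
  proof (rule tendsto_sandwich)
    show "((\<lambda>N. \<delta> - inverse (real (m N))) \<longlongrightarrow> \<delta>) G"
      using tendsto_diff[OF tendsto_const tendsto_inverse_0_at_top[OF mr]] by simp
    show "((\<lambda>N. \<delta>) \<longlongrightarrow> \<delta>) G" by simp
    have ev: "\<forall>\<^sub>F N in G. real (m N) > 0"
      by (rule eventually_compose_filterlim[OF eventually_gt_at_top mr])
    show "\<forall>\<^sub>F N in G. \<delta> - inverse (real (m N)) \<le> real (l N) / real (m N)"
      using ev
    proof eventually_elim
      case (elim N)
      have "\<delta> * real (m N) - 1 \<le> real (l N)" using \<delta> unfolding l_def by linarith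
      then have "(\<delta> * real (m N) - 1) / real (m N) \<le> real (l N) / real (m N)"
        by (rule divide_right_mono) simp
      then show ?case using elim by (simp add: diff_divide_distrib inverse_eq_divide)
    qed
    show "\<forall>\<^sub>F N in G. real (l N) / real (m N) \<le> \<delta>"
      using ev
    proof eventually_elim
      case (elim N)
      have "\<delta> * real (m N) \<ge> 0" using \<delta> by simp
      then have "real (l N) \<le> \<delta> * real (m N)" unfolding l_def by linarith
      then show ?case using elim by (simp add: field_simps)
    qed
  qed
  have "\<forall>\<^sub>F N in G. real (n N) / real (m N) - real (l N) / real (m N) > 0"
    by (rule order_tendstoD(1)[OF tendsto_diff[OF n l_lim]]) (use \<delta> in simp)
  then have ln: "\<forall>\<^sub>F N in G. l N \<le> n N"
    by eventually_elim (auto simp flip: diff_divide_distrib simp: zero_less_divide_iff)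
  have nl: "((\<lambda>N. real (n N - l N) / real (m N)) \<longlongrightarrow> r - \<delta>) G"
    by (rule Lim_transform_eventually[OF tendsto_diff[OF n l_lim]], use ln in eventually_elim)
      (simp add: of_nat_diff diff_divide_distrib)
  have up: "\<forall>\<^sub>F N in G. (z / w1) ^ n N * (F w1 / F z) ^ m N \<le> 1 / 4"
    using w1 pos z0 by (intro eventually_powers_le[OF m n]) (auto simp: H_def ln_div algebra_simps)
  have lo: "\<forall>\<^sub>F N in G. (z / w2) ^ (n N - l N) * (F w2 / F z) ^ m N \<le> 1 / 4"
    using w2 pos z0 by (intro eventually_powers_le[OF m nl]) (auto simp: H_def ln_div algebra_simps)
  define v where "v = exp (ln (F x) - r * ln x - e) * (2 / q) powr \<delta> / F z"
  have vpos: "v > 0" using pos q by (simp add: v_def)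
  have "ln v = ln (F x) - r * ln x - e + \<delta> * ln (2 / q) - ln (F z)"
    unfolding v_def using pos q by (simp add: ln_div ln_mult ln_powr)
  also have "\<dots> < - (r * ln z)" using z(2) \<delta>e e by (simp add: H_def)
  finally have main: "\<forall>\<^sub>F N in G. z ^ n N * v ^ m N \<le> 1 / 2"
    using vpos z0 by (intro eventually_powers_le[OF m n]) auto
  have quarter: "u * v ^ k \<le> s ^ k / 4" if "u * (v / s) ^ k \<le> 1 / 4" "s > 0" for u v s :: real and k
    using that zero_less_power[of s k] by (simp add: power_divide field_simps)
  have ev: "\<forall>\<^sub>F N in G. m N > 0"
    by (rule eventually_compose_filterlim[OF eventually_gt_at_top m])
  show ?thesis
    using ev ln up lo main
  proof eventually_elim
    case (elim N)
    let ?b = "fps_nth (Abs_fps f ^ m N) (n N)"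
    have "F z ^ m N \<le> real (Suc (l N)) * (?b * z ^ n N) / q ^ l N
       + (z / w1) ^ n N * F w1 ^ m N + (z / w2) ^ (n N - l N) * F w2 ^ m N"
      using w1 w2 z0 q qz elim
      by (intro fps_power_coefficient_ge[of f c] f c F) auto
    moreover have "(z / w1) ^ n N * F w1 ^ m N \<le> F z ^ m N / 4"
      using quarter[OF elim(3)] pos by simp
    moreover have "(z / w2) ^ (n N - l N) * F w2 ^ m N \<le> F z ^ m N / 4"
      using quarter[OF elim(4)] pos by simp
    ultimately have "F z ^ m N / 2 \<le> real (Suc (l N)) * (?b * z ^ n N) / q ^ l N" by simp
    also have "\<dots> \<le> 2 ^ l N * (?b * z ^ n N) / q ^ l N"
    proof -
      have "Suc (l N) \<le> 2 ^ l N" by (simp add: Suc_leI)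
      then have "real (Suc (l N)) \<le> 2 ^ l N" by (metis of_nat_le_iff of_nat_numeral of_nat_power)
      then show ?thesis
        using q z0 fps_power_nth_nonneg[OF f]
        by (intro divide_right_mono mult_right_mono) auto
    qed
    also have "\<dots> = (2 / q) ^ l N * (?b * z ^ n N)" by (simp add: power_divide)
    also have "\<dots> \<le> ((2 / q) powr \<delta>) ^ m N * (?b * z ^ n N)"
    proof -
      have "\<delta> * real (m N) \<ge> 0" using \<delta> by simp
      then have "real (l N) \<le> \<delta> * real (m N)" unfolding l_def by linarith
      then have "(2 / q) powr real (l N) \<le> (2 / q) powr (\<delta> * real (m N))"
        using q by (intro powr_mono) auto
      then have "(2 / q) ^ l N \<le> ((2 / q) powr \<delta>) ^ m N"
        using q by (simp add: powr_realpow powr_powr[symmetric])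
      then show ?thesis
        using z0 fps_power_nth_nonneg[OF f] by (intro mult_right_mono) auto
    qed
    finally have A: "F z ^ m N \<le> 2 * ((2 / q) powr \<delta>) ^ m N * (?b * z ^ n N)" by simp
    have "z ^ n N * exp (real (m N) * (ln (F x) - r * ln x - e)) * ((2 / q) powr \<delta>) ^ m N
        = (z ^ n N * v ^ m N) * F z ^ m N"
      unfolding v_def using pos by (simp add: power_divide power_mult_distrib exp_of_nat_mult)
    also have "\<dots> \<le> 1 / 2 * F z ^ m N" using elim(5) pos by (intro mult_right_mono) auto
    also have "\<dots> \<le> ((2 / q) powr \<delta>) ^ m N * (?b * z ^ n N)" using A by simp
    also have "\<dots> = z ^ n N * ?b * ((2 / q) powr \<delta>) ^ m N" by simp
    finally show ?case using z0 q by simp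
  qed
qed

text \<open>
  The coefficientwise bound \<open>[z ^ n] (g z * F z ^ m) \<le> A * F z ^ m / z ^ n\<close>, where the
  convergence of \<open>g\<close> is replaced by boundedness of \<open>y 0 n * z ^ n\<close>: in the recursion for \<open>y 0\<close>
  the prefactor \<open>1 / Suc n\<close> eventually beats the constant \<open>K * z * F\<close>.
\<close>

lemma convolution_recursion_upper:
  fixes f :: "nat \<Rightarrow> real" and y :: "nat \<Rightarrow> nat \<Rightarrow> real"
  assumes f: "\<And>k. f k \<ge> 0" and y: "\<And>m n. y m n \<ge> 0"
    and rec: "\<And>m n. y (Suc m) n = (\<Sum>j\<le>n. f j * y m (n - j))"
    and init: "\<And>n. real (Suc n) * y 0 (Suc n) \<le> K * (\<Sum>j\<le>n. f j * y 0 (n - j))"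
    and K: "K \<ge> 0" and z: "z > 0" and F: "(\<lambda>k. f k * z ^ k) sums F"
  shows "\<exists>A>0. \<forall>m n. y m n * z ^ n \<le> A * F ^ m"
proof -
  have partial: "(\<Sum>j\<le>n. f j * z ^ j) \<le> F" for n
    using sum_le_suminf[of "\<lambda>k. f k * z ^ k" "{..n}"] F f z by (simp add: sums_iff)
  have F0: "F \<ge> 0" using partial[of 0] f[of 0] by simp
  have conv: "(\<Sum>j\<le>n. f j * g (n - j)) * z ^ n \<le> F * A"
    if "\<And>k. k \<le> n \<Longrightarrow> g k * z ^ k \<le> A" "A \<ge> 0" for g :: "nat \<Rightarrow> real" and A n
  proof -
    have "(\<Sum>j\<le>n. f j * g (n - j)) * z ^ n = (\<Sum>j\<le>n. (f j * z ^ j) * (g (n - j) * z ^ (n - j)))"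
      unfolding sum_distrib_right by (rule sum.cong) (simp_all add: mult_ac flip: power_add)
    also have "\<dots> \<le> (\<Sum>j\<le>n. (f j * z ^ j) * A)"
      using that f z by (intro sum_mono mult_left_mono) auto
    also have "\<dots> \<le> F * A"
      unfolding sum_distrib_right[symmetric] using partial that by (intro mult_right_mono) auto
    finally show ?thesis .
  qed
  obtain n0 :: nat where n0: "K * z * F \<le> real n0" using real_arch_simple by blast
  define A where "A = 1 + (\<Sum>k\<le>n0. y 0 k * z ^ k)"
  have Apos: "A > 0" unfolding A_def using y z by (intro add_pos_nonneg sum_nonneg) auto
  have base: "y 0 n * z ^ n \<le> A" for n
  proof (induction n rule: less_induct)
    case (less n)
    show ?case
    proof (cases "n \<le> n0")
      case True
      then have "y 0 n * z ^ n \<le> (\<Sum>k\<le>n0. y 0 k * z ^ k)"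
        using y z by (intro member_le_sum[of n "{..n0}" "\<lambda>k. y 0 k * z ^ k"]) auto
      then show ?thesis by (simp add: A_def)
    next
      case False
      then obtain k where k: "n = Suc k" "n0 \<le> k" by (cases n) auto
      have "real (Suc k) * (y 0 n * z ^ n) \<le> K * (\<Sum>j\<le>k. f j * y 0 (k - j)) * z ^ n"
        using init[of k] z k by (simp add: mult.assoc[symmetric] mult_right_mono)
      also have "\<dots> = K * z * ((\<Sum>j\<le>k. f j * y 0 (k - j)) * z ^ k)" by (simp add: k)
      also have "\<dots> \<le> K * z * (F * A)"
        using less k K z Apos by (intro mult_left_mono conv) auto
      also have "\<dots> = (K * z * F) * A" by simp
      also have "\<dots> \<le> real (Suc k) * A"
        using n0 k Apos by (intro mult_right_mono) auto
      finally show ?thesis by (simp del: of_nat_Suc)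
    qed
  qed
  have "y m n * z ^ n \<le> A * F ^ m" for m n
  proof (induction m arbitrary: n)
    case (Suc m)
    have "y (Suc m) n * z ^ n \<le> F * (A * F ^ m)"
      unfolding rec using Suc Apos F0 by (intro conv) auto
    then show ?case by (simp add: mult_ac)
  qed (use base in simp)
  then show ?thesis using Apos by blast
qed

section \<open>The generating function of the path weights\<close>

text \<open>
  The transfer matrix \<open>D C\<close> has trace \<open>exp \<beta> * field_trace B\<close> and determinant \<open>edge_det \<beta>\<close>.
\<close>

definition field_trace :: "real \<Rightarrow> real" where
  "field_trace B = exp B + exp (- B)"

definition edge_det :: "real \<Rightarrow> real" where
  "edge_det \<beta> = exp \<beta> ^ 2 - exp (- \<beta>) ^ 2"

definition edge_gap :: "real \<Rightarrow> real" where
  "edge_gap \<beta> = exp \<beta> - exp (- \<beta>)"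

lemma field_trace_ge_2: "field_trace B \<ge> 2"
proof -
  have "(exp (B / 2) - exp (- (B / 2))) ^ 2 \<ge> 0" by simp
  then show ?thesis
    by (simp add: power2_eq_square field_trace_def algebra_simps flip: exp_add)
qed

lemma edge_det_nonneg: "\<beta> \<ge> 0 \<Longrightarrow> edge_det \<beta> \<ge> 0"
  by (simp add: edge_det_def)

lemma transfer_pos: "fst (transfer \<beta> B k) > 0 \<and> snd (transfer \<beta> B k) > 0"
  by (induction k) (auto simp: split_beta intro!: mult_pos_pos add_pos_pos)

lemma line_weight_pos: "line_weight \<beta> B k > 0"
  unfolding line_weight_def using transfer_pos[of \<beta> B "Suc k"] by (simp del: transfer.simps)

lemma exp_mult_exp_uminus: "exp x * exp (- x) = (1::real)"
  by (simp flip: exp_add)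

text \<open>
  The transfer matrix is monotone on nonnegative vectors, so it suffices to compare the first
  two vectors.
\<close>

lemma transfer_ge:
  assumes "\<beta> \<ge> 0"
  shows "fst (transfer \<beta> B (Suc k)) \<ge> exp (- \<beta>) * fst (transfer \<beta> B k) \<and>
    snd (transfer \<beta> B (Suc k)) \<ge> exp (- \<beta>) * snd (transfer \<beta> B k)"
proof (induction k)
  case 0
  have s: "field_trace B \<ge> 1" using field_trace_ge_2[of B] by simp
  have b: "exp (- \<beta>) \<le> exp \<beta>" using assms by simp
  have "exp (- \<beta>) * 1 \<le> exp (- \<beta>) * field_trace B" using s by (intro mult_left_mono) auto
  also have "\<dots> \<le> exp \<beta> * exp B + exp (- \<beta>) * exp (- B)"
    using b by (simp add: field_trace_def distrib_left)
  finally have 1: "exp (- \<beta>) \<le> exp \<beta> * exp B + exp (- \<beta>) * exp (- B)" by simp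
  have "exp (- \<beta>) * 1 \<le> exp (- \<beta>) * field_trace B" using s by (intro mult_left_mono) auto
  also have "\<dots> \<le> exp (- \<beta>) * exp B + exp \<beta> * exp (- B)"
    using b by (simp add: field_trace_def distrib_left)
  finally have 2: "exp (- \<beta>) \<le> exp (- \<beta>) * exp B + exp \<beta> * exp (- B)" by simp
  show ?case using mult_left_mono[OF 1, of "exp B"] mult_left_mono[OF 2, of "exp (- B)"]
    by (simp add: mult_ac)
next
  case (Suc k)
  let ?u = "fst (transfer \<beta> B k)" and ?v = "snd (transfer \<beta> B k)"
  let ?u' = "fst (transfer \<beta> B (Suc k))" and ?v' = "snd (transfer \<beta> B (Suc k))"
  have *: "exp (- \<beta>) * (t * (a * ?u + b * ?v)) \<le> t * (a * ?u' + b * ?v')"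
    if "t \<ge> 0" "a \<ge> 0" "b \<ge> 0" for t a b
  proof -
    have "exp (- \<beta>) * (t * (a * ?u + b * ?v)) =
        t * (a * (exp (- \<beta>) * ?u) + b * (exp (- \<beta>) * ?v))" by (simp add: algebra_simps)
    also have "\<dots> \<le> t * (a * ?u' + b * ?v')"
      using that Suc by (intro mult_left_mono add_mono) auto
    finally show ?thesis .
  qed
  have T: "fst (transfer \<beta> B (Suc j)) = exp B * (exp \<beta> * fst (transfer \<beta> B j) + exp (- \<beta>) * snd (transfer \<beta> B j))"
    "snd (transfer \<beta> B (Suc j)) = exp (- B) * (exp (- \<beta>) * fst (transfer \<beta> B j) + exp \<beta> * snd (transfer \<beta> B j))" for j
    by (simp_all add: split_beta)
  show ?case
    unfolding T(1)[of "Suc k"] T(2)[of "Suc k"]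
    using *[of "exp B" "exp \<beta>" "exp (- \<beta>)"] *[of "exp (- B)" "exp (- \<beta>)" "exp \<beta>"]
    by (simp only: T(1)[of k] T(2)[of k]) simp
qed

lemma line_weight_Suc_ge:
  assumes "\<beta> \<ge> 0"
  shows "line_weight \<beta> B (Suc k) \<ge> exp (- \<beta>) * line_weight \<beta> B k"
  using transfer_ge[OF assms, of B "Suc k"]
  by (simp add: line_weight_def distrib_left del: transfer.simps)

text \<open>
  The theorem of Cayley and Hamilton for the transfer matrix, applied to the sum of the two
  entries.
\<close>

lemma transfer_sum_rec:
  "fst (transfer \<beta> B (Suc (Suc k))) + snd (transfer \<beta> B (Suc (Suc k))) =
     exp \<beta> * field_trace B * (fst (transfer \<beta> B (Suc k)) + snd (transfer \<beta> B (Suc k)))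
     - edge_det \<beta> * (fst (transfer \<beta> B k) + snd (transfer \<beta> B k))"
proof -
  have main: "X * (a * U + b * V) + Y * (b * U + a * V) =
      a * (X + Y) * (U + V) - (a ^ 2 - b ^ 2) * (u + v)"
    if "X * Y = 1" "U = X * (a * u + b * v)" "V = Y * (b * u + a * v)"
    for X Y a b u v U V :: real
  proof -
    have "a * (X + Y) * (U + V) - (X * (a * U + b * V) + Y * (b * U + a * V)) =
       (a - b) * (X * V + Y * U)" by (simp add: algebra_simps)
    also have "X * V + Y * U = (X * Y) * ((b * u + a * v) + (a * u + b * v))"
      unfolding that(2,3) by (simp add: algebra_simps)
    also have "(a - b) * \<dots> = (a ^ 2 - b ^ 2) * (u + v)"
      unfolding that(1) by (simp add: algebra_simps power2_eq_square)
    finally show ?thesis by simp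
  qed
  show ?thesis
    unfolding field_trace_def edge_det_def
    by (simp only: transfer.simps(2)[of _ _ "Suc k"] split_beta Let_def fst_conv snd_conv,
        rule main[OF exp_mult_exp_uminus]) (simp_all add: split_beta)
qed

lemma line_weight_0: "line_weight \<beta> B 0 = exp \<beta> * field_trace B ^ 2 - 2 * edge_gap \<beta>"
proof -
  have "X * (a * X + b * Y) + Y * (b * X + a * Y) = a * (X + Y) ^ 2 - 2 * (a - b)"
    if "X * Y = 1" for X Y a b :: real
  proof -
    have "X * (a * X + b * Y) + Y * (b * X + a * Y) = a * (X + Y) ^ 2 - 2 * (a - b) * (X * Y)"
      by (simp add: algebra_simps power2_eq_square)
    then show ?thesis using that by simp
  qed
  from this[OF exp_mult_exp_uminus] show ?thesis
    by (simp add: line_weight_def field_trace_def edge_gap_def)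
qed

lemma line_weight_1:
  "line_weight \<beta> B (Suc 0) = exp \<beta> * field_trace B * line_weight \<beta> B 0 - edge_det \<beta> * field_trace B"
  using transfer_sum_rec[of \<beta> B 0] unfolding line_weight_def
  by (simp add: field_trace_def del: transfer.simps(2))

lemma line_weight_rec:
  "line_weight \<beta> B (Suc (Suc k)) =
     exp \<beta> * field_trace B * line_weight \<beta> B (Suc k) - edge_det \<beta> * line_weight \<beta> B k"
  unfolding line_weight_def by (rule transfer_sum_rec)

text \<open>
  The square root of the discriminant of the characteristic polynomial of the transfer matrix.
\<close>

definition eigenvalue_gap :: "real \<Rightarrow> real \<Rightarrow> real" where
  "eigenvalue_gap \<beta> B = sqrt ((exp \<beta> * field_trace B) ^ 2 - 4 * edge_det \<beta>)"

definition top_eigenvalue :: "real \<Rightarrow> real \<Rightarrow> real" where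
  "top_eigenvalue \<beta> B = (exp \<beta> * field_trace B + eigenvalue_gap \<beta> B) / 2"

definition low_eigenvalue :: "real \<Rightarrow> real \<Rightarrow> real" where
  "low_eigenvalue \<beta> B = (exp \<beta> * field_trace B - eigenvalue_gap \<beta> B) / 2"

lemma eigenvalue_gap_ge: "2 * exp (- \<beta>) \<le> eigenvalue_gap \<beta> B"
  and eigenvalue_gap_sq: "eigenvalue_gap \<beta> B ^ 2 = (exp \<beta> * field_trace B) ^ 2 - 4 * edge_det \<beta>"
proof -
  have "2 ^ 2 \<le> field_trace B ^ 2" using field_trace_ge_2[of B] by (intro power_mono) auto
  then have "exp \<beta> ^ 2 * 2 ^ 2 \<le> exp \<beta> ^ 2 * field_trace B ^ 2" by (intro mult_left_mono) auto
  then have 1: "(2 * exp (- \<beta>)) ^ 2 \<le> (exp \<beta> * field_trace B) ^ 2 - 4 * edge_det \<beta>"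
    by (simp add: edge_det_def power_mult_distrib algebra_simps)
  then show "2 * exp (- \<beta>) \<le> eigenvalue_gap \<beta> B" unfolding eigenvalue_gap_def by (rule real_le_rsqrt)
  have "0 \<le> (2 * exp (- \<beta>)) ^ 2" by simp
  with 1 show "eigenvalue_gap \<beta> B ^ 2 = (exp \<beta> * field_trace B) ^ 2 - 4 * edge_det \<beta>"
    unfolding eigenvalue_gap_def by (intro real_sqrt_pow2) linarith
qed

lemma eigenvalue_sum: "top_eigenvalue \<beta> B + low_eigenvalue \<beta> B = exp \<beta> * field_trace B"
  by (simp add: top_eigenvalue_def low_eigenvalue_def field_simps)

lemma eigenvalue_prod: "top_eigenvalue \<beta> B * low_eigenvalue \<beta> B = edge_det \<beta>"
proof -
  have "top_eigenvalue \<beta> B * low_eigenvalue \<beta> B = ((exp \<beta> * field_trace B) ^ 2 - eigenvalue_gap \<beta> B ^ 2) / 4"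
    by (simp add: top_eigenvalue_def low_eigenvalue_def field_simps power2_eq_square)
  then show ?thesis by (simp add: eigenvalue_gap_sq)
qed

lemma low_less_top: "low_eigenvalue \<beta> B < top_eigenvalue \<beta> B"
proof -
  have "eigenvalue_gap \<beta> B > 0" using eigenvalue_gap_ge[of \<beta> B] exp_gt_zero[of "- \<beta>"] by linarith
  then show ?thesis by (simp add: top_eigenvalue_def low_eigenvalue_def)
qed

lemma top_eigenvalue_ge: "exp \<beta> + exp (- \<beta>) \<le> top_eigenvalue \<beta> B"
proof -
  have "exp \<beta> * 2 \<le> exp \<beta> * field_trace B"
    using field_trace_ge_2[of B] by (intro mult_left_mono) auto
  from add_mono[OF this eigenvalue_gap_ge[of \<beta> B]]
  have "2 * (exp \<beta> + exp (- \<beta>)) \<le> exp \<beta> * field_trace B + eigenvalue_gap \<beta> B"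
    by (simp only: distrib_left mult.commute)
  then show ?thesis by (simp add: top_eigenvalue_def)
qed

lemma top_eigenvalue_pos: "top_eigenvalue \<beta> B > 0"
  using top_eigenvalue_ge[of \<beta> B] by (rule less_le_trans[rotated]) (intro add_pos_pos, auto)

lemma low_eigenvalue_nonneg: "\<beta> \<ge> 0 \<Longrightarrow> low_eigenvalue \<beta> B \<ge> 0"
  using eigenvalue_prod[of \<beta> B] edge_det_nonneg[of \<beta>] top_eigenvalue_pos[of \<beta> B]
  by (metis mult_less_0_iff not_less order.asym)

text \<open>
  Numerator and denominator of the generating function of the path weights. The denominator is
  the reversed characteristic polynomial of the transfer matrix.
\<close>

definition line_num :: "real \<Rightarrow> real \<Rightarrow> real \<Rightarrow> real" where
  "line_num \<beta> B z = exp \<beta> * field_trace B ^ 2 - 2 * edge_gap \<beta> - field_trace B * edge_det \<beta> * z"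

definition line_den :: "real \<Rightarrow> real \<Rightarrow> real \<Rightarrow> real" where
  "line_den \<beta> B z = 1 - exp \<beta> * field_trace B * z + edge_det \<beta> * z ^ 2"

definition line_gf :: "real \<Rightarrow> real \<Rightarrow> real \<Rightarrow> real" where
  "line_gf \<beta> B z = line_num \<beta> B z / line_den \<beta> B z"

lemma line_den_factor:
  "line_den \<beta> B z = (1 - top_eigenvalue \<beta> B * z) * (1 - low_eigenvalue \<beta> B * z)"
proof -
  have "(1 - top_eigenvalue \<beta> B * z) * (1 - low_eigenvalue \<beta> B * z) =
      1 - (top_eigenvalue \<beta> B + low_eigenvalue \<beta> B) * z
        + top_eigenvalue \<beta> B * low_eigenvalue \<beta> B * z ^ 2"
    by (simp add: algebra_simps power2_eq_square)
  then show ?thesis unfolding eigenvalue_sum eigenvalue_prod by (simp add: line_den_def)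
qed

lemma line_den_pos:
  assumes "\<beta> \<ge> 0" "z \<ge> 0" "top_eigenvalue \<beta> B * z < 1"
  shows "line_den \<beta> B z > 0"
proof -
  have "low_eigenvalue \<beta> B * z \<le> top_eigenvalue \<beta> B * z"
    using low_less_top[of \<beta> B] assms by (intro mult_right_mono) auto
  then show ?thesis unfolding line_den_factor using assms by simp
qed

text \<open>
  The path weights are a combination of the powers of the two eigenvalues, so their generating
  function is a sum of two geometric series and converges up to the inverse of the top
  eigenvalue.
\<close>

lemma line_weight_sums:
  assumes "\<beta> \<ge> 0" "z \<ge> 0" "top_eigenvalue \<beta> B * z < 1"
  shows "(\<lambda>k. line_weight \<beta> B k * z ^ k) sums line_gf \<beta> B z"
proof -
  define l m where "l = top_eigenvalue \<beta> B" and "m = low_eigenvalue \<beta> B"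
  let ?f = "line_weight \<beta> B"
  define A C where "A = (?f 1 - m * ?f 0) / (l - m)" and "C = (l * ?f 0 - ?f 1) / (l - m)"
  have lm: "m < l" "l + m = exp \<beta> * field_trace B" "l * m = edge_det \<beta>" "0 \<le> m"
    using low_less_top eigenvalue_sum eigenvalue_prod low_eigenvalue_nonneg[OF assms(1)]
    by (auto simp: l_def m_def)
  have AC: "A + C = ?f 0" "A * l + C * m = ?f 1"
  proof -
    have "A + C = (l - m) * ?f 0 / (l - m)"
      unfolding A_def C_def add_divide_distrib[symmetric] by (simp add: algebra_simps)
    then show "A + C = ?f 0" using lm(1) by simp
    have "A * l + C * m = (l - m) * ?f 1 / (l - m)"
      unfolding A_def C_def times_divide_eq_left add_divide_distrib[symmetric]
      by (simp add: algebra_simps)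
    then show "A * l + C * m = ?f 1" using lm(1) by simp
  qed
  have closed: "?f k = A * l ^ k + C * m ^ k \<and> ?f (Suc k) = A * l ^ Suc k + C * m ^ Suc k" for k
  proof (induction k)
    case 0
    then show ?case using AC by simp
  next
    case (Suc k)
    have "?f (Suc (Suc k)) = (l + m) * (A * l ^ Suc k + C * m ^ Suc k) - l * m * (A * l ^ k + C * m ^ k)"
      unfolding line_weight_rec lm(2,3)[symmetric] using Suc by metis
    then show ?case using Suc by (simp add: algebra_simps)
  qed
  have mz: "m * z < 1" "l * z < 1" "0 \<le> m * z" "0 \<le> l * z"
    using mult_right_mono[of m l z] lm assms by (auto simp: l_def)
  have "(\<lambda>k. A * (l * z) ^ k + C * (m * z) ^ k) sums (A * (1 / (1 - l * z)) + C * (1 / (1 - m * z)))"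
    using mz by (intro sums_add sums_mult geometric_sums) auto
  moreover have "A * (l * z) ^ k + C * (m * z) ^ k = ?f k * z ^ k" for k
    using closed[of k] by (simp add: power_mult_distrib algebra_simps)
  moreover have "A * (1 / (1 - l * z)) + C * (1 / (1 - m * z)) = line_gf \<beta> B z"
  proof -
    have "A * (1 / (1 - l * z)) + C * (1 / (1 - m * z)) =
        ((A + C) - (A * m + C * l) * z) / ((1 - l * z) * (1 - m * z))"
      using mz by (simp add: field_simps)
    also have "A * m + C * l = (A + C) * (l + m) - (A * l + C * m)" by (simp add: algebra_simps)
    also have "(A + C) - ((A + C) * (l + m) - (A * l + C * m)) * z = line_num \<beta> B z"
      unfolding AC lm using line_weight_0[of \<beta> B]
      by (simp add: line_weight_1 line_num_def algebra_simps)
    finally show ?thesis by (simp add: line_gf_def line_den_factor l_def m_def)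
  qed
  ultimately show ?thesis by simp
qed

lemma line_gf_pos:
  assumes "\<beta> \<ge> 0" "z \<ge> 0" "top_eigenvalue \<beta> B * z < 1"
  shows "line_gf \<beta> B z > 0"
proof -
  have "0 < (\<Sum>k<1. line_weight \<beta> B k * z ^ k)" using line_weight_pos[of \<beta> B 0] by simp
  also have "\<dots> \<le> line_gf \<beta> B z"
    using line_weight_sums[OF assms] assms less_imp_le[OF line_weight_pos]
    using sum_le_suminf[of "\<lambda>k. line_weight \<beta> B k * z ^ k" "{..<1}"]
    by (auto simp: sums_iff)
  finally show ?thesis .
qed

definition line_gf_deriv :: "real \<Rightarrow> real \<Rightarrow> real \<Rightarrow> real" where
  "line_gf_deriv \<beta> B z = (- (field_trace B * edge_det \<beta>) * line_den \<beta> B z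
     - line_num \<beta> B z * (2 * edge_det \<beta> * z - exp \<beta> * field_trace B)) / (line_den \<beta> B z) ^ 2"

lemma line_gf_has_deriv:
  assumes "line_den \<beta> B z \<noteq> 0"
  shows "(line_gf \<beta> B has_real_derivative line_gf_deriv \<beta> B z) (at z)"
  using assms unfolding line_gf_def [abs_def] line_gf_deriv_def line_num_def line_den_def
  by (auto intro!: derivative_eq_intros simp: power2_eq_square field_simps)

lemma isCont_line_gf_deriv:
  assumes "line_den \<beta> B z \<noteq> 0"
  shows "isCont (line_gf_deriv \<beta> B) z"
  using assms unfolding line_gf_deriv_def [abs_def] line_num_def line_den_def
  by (intro continuous_intros) auto

text \<open>
  The inverse of the top eigenvalue is a genuine pole: the numerator does not vanish there,
  because \<open>field_trace B \<ge> 2\<close> and the top eigenvalue is at least \<open>exp \<beta> + exp (- \<beta>)\<close>.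
\<close>

lemma line_gf_unbounded:
  assumes \<beta>: "\<beta> \<ge> 0" and z0: "0 \<le> z0" "z0 < 1 / top_eigenvalue \<beta> B"
  shows "\<exists>z. z0 < z \<and> z < 1 / top_eigenvalue \<beta> B \<and> line_gf \<beta> B z > C"
proof -
  define l where "l = top_eigenvalue \<beta> B"
  have l: "l > 0" unfolding l_def by (rule top_eigenvalue_pos)
  define c where "c = line_num \<beta> B (1 / l)"
  have s: "field_trace B \<ge> 2" by (rule field_trace_ge_2)
  have "c = field_trace B * l - 2 * edge_gap \<beta>"
  proof -
    have "c = field_trace B * (exp \<beta> * field_trace B) - 2 * edge_gap \<beta> - field_trace B * (edge_det \<beta> / l)"
      by (simp add: c_def line_num_def power2_eq_square)
    also have "edge_det \<beta> / l = low_eigenvalue \<beta> B"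
      using eigenvalue_prod[of \<beta> B] l by (simp add: l_def field_simps)
    also have "exp \<beta> * field_trace B = l + low_eigenvalue \<beta> B"
      by (simp add: l_def eigenvalue_sum)
    finally show ?thesis by (simp add: algebra_simps)
  qed
  also have "\<dots> \<ge> 2 * (exp \<beta> + exp (- \<beta>)) - 2 * edge_gap \<beta>"
    using s top_eigenvalue_ge[of \<beta> B] by (intro diff_right_mono mult_mono) (auto simp: l_def intro: add_nonneg_nonneg)
  finally have "4 * exp (- \<beta>) \<le> c" by (simp add: edge_gap_def algebra_simps)
  moreover have "4 * exp (- \<beta>) > 0" by simp
  ultimately have c: "c > 0" by (rule less_le_trans[rotated])
  define K where "K = max C 1"
  define z where "z = max ((z0 + 1 / l) / 2) (1 / l - c / (2 * K * l))"
  have K: "K > 0" "K \<ge> C" by (auto simp: K_def)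
  have "c / (2 * K * l) > 0" using c K l by simp
  then have z: "z0 < z" "z < 1 / l" "z > 0" "z \<ge> 1 / l - c / (2 * K * l)"
  proof -
    have z0l: "z0 < 1 / l" using z0 by (simp add: l_def)
    then have "z0 < (z0 + 1 / l) / 2" by (simp add: field_simps)
    also have "\<dots> \<le> z" by (simp add: z_def)
    finally show "z0 < z" .
    then show "z > 0" using z0 by linarith
    show "z < 1 / l" using z0l \<open>c / (2 * K * l) > 0\<close> by (simp add: z_def)
  qed (simp add: z_def)
  have lz: "l * z < 1" using z l by (simp add: field_simps)
  have mz: "0 \<le> low_eigenvalue \<beta> B * z" using low_eigenvalue_nonneg[OF \<beta>] z by simp
  have "l * z \<ge> 1 - c / (2 * K)"
  proof -
    have "l * z \<ge> l * (1 / l - c / (2 * K * l))" using z l by (intro mult_left_mono) auto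
    then show ?thesis using l by (simp add: algebra_simps)
  qed
  then have d1: "1 - l * z \<le> c / (2 * K)" by simp
  have den: "line_den \<beta> B z > 0" using line_den_pos[OF \<beta>, of z B] z lz by (simp add: l_def)
  have "line_den \<beta> B z \<le> (1 - l * z) * 1"
    unfolding line_den_factor l_def[symmetric] using mz lz by (intro mult_left_mono) auto
  also have "\<dots> \<le> c / (2 * K)" using d1 by simp
  finally have d: "line_den \<beta> B z \<le> c / (2 * K)" .
  have num: "line_num \<beta> B z \<ge> c"
    unfolding c_def line_num_def using z s edge_det_nonneg[OF \<beta>]
    by (intro diff_left_mono mult_left_mono) auto
  have "C < 2 * K" using K by simp
  also have "2 * K = c / (c / (2 * K))" using c K by simp
  also have "\<dots> \<le> line_num \<beta> B z / line_den \<beta> B z"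
    using num den d c by (intro frac_le) auto
  finally show ?thesis using z unfolding l_def line_gf_def by blast
qed

text \<open>
  The logarithmic derivative \<open>z * F' z / F z\<close> vanishes at 0 and exceeds \<open>r\<close> somewhere:
  otherwise \<open>F z / z powr r\<close> would be nonincreasing, whereas \<open>F\<close> has a pole at the radius of
  convergence. The point where the value \<open>r\<close> is attained for the first time has all the
  required properties.
\<close>

lemma saddle_point_exists:
  assumes \<beta>: "\<beta> \<ge> 0" and r: "r > 0"
  shows "\<exists>x. 0 < x \<and> top_eigenvalue \<beta> B * x < 1 \<and>
    x * line_gf_deriv \<beta> B x / line_gf \<beta> B x = r \<and>
    (\<forall>z. 0 < z \<longrightarrow> z < x \<longrightarrow> z * line_gf_deriv \<beta> B z / line_gf \<beta> B z < r)"
proof -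
  define R where "R = 1 / top_eigenvalue \<beta> B"
  have R: "R > 0" unfolding R_def using top_eigenvalue_pos by simp
  have lR: "top_eigenvalue \<beta> B * z < 1 \<longleftrightarrow> z < R" for z
    using top_eigenvalue_pos[of \<beta> B] by (simp add: R_def field_simps)
  define \<kappa> where "\<kappa> z = z * line_gf_deriv \<beta> B z / line_gf \<beta> B z" for z
  have pos: "line_gf \<beta> B z > 0" "line_den \<beta> B z > 0" if "0 \<le> z" "z < R" for z
    using that line_gf_pos[OF \<beta>, of z B] line_den_pos[OF \<beta>, of z B] by (auto simp: lR)
  have cont: "isCont \<kappa> z" if "0 \<le> z" "z < R" for z
    unfolding \<kappa>_def [abs_def] using pos[OF that]
    by (intro continuous_intros isCont_line_gf_deriv DERIV_isCont[OF line_gf_has_deriv]) auto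
  define H where "H z = ln (line_gf \<beta> B z) - r * ln z" for z
  have H': "(H has_real_derivative (\<kappa> z - r) / z) (at z)" if "0 < z" "z < R" for z
    unfolding H_def [abs_def] \<kappa>_def using that pos[of z]
    by (auto intro!: derivative_eq_intros line_gf_has_deriv simp: field_simps)
  have "0 \<le> R / 2" "R / 2 < 1 / top_eigenvalue \<beta> B" using R by (simp_all flip: R_def)
  from line_gf_unbounded[OF \<beta> this, of "exp (H (R / 2) + r * ln R)"]
  obtain z1 where z1: "R / 2 < z1" "z1 < R" "exp (H (R / 2) + r * ln R) < line_gf \<beta> B z1"
    by (auto simp: R_def)
  have "ln z1 < ln R" using z1 R by simp
  then have "r * ln z1 < r * ln R" using r by simp
  moreover have "H (R / 2) + r * ln R < ln (line_gf \<beta> B z1)"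
    using z1 pos[of z1] R by (subst exp_less_cancel_iff[symmetric]) auto
  ultimately have "H (R / 2) < H z1" unfolding H_def[of z1] by simp
  moreover obtain \<xi> where \<xi>: "R / 2 < \<xi>" "\<xi> < z1" "H z1 - H (R / 2) = (z1 - R / 2) * ((\<kappa> \<xi> - r) / \<xi>)"
    using MVT2[of "R / 2" z1 H "\<lambda>z. (\<kappa> z - r) / z"] z1 H' R by fastforce
  ultimately have "(z1 - R / 2) * ((\<kappa> \<xi> - r) / \<xi>) > 0" by simp
  then have \<xi>r: "\<kappa> \<xi> > r" using z1 \<xi> R by (simp add: zero_less_mult_iff zero_less_divide_iff)
  have contS: "continuous_on {0..\<xi>} \<kappa>"
    using cont \<xi> z1 by (intro continuous_at_imp_continuous_on) auto
  define S where "S = {z \<in> {0..\<xi>}. r \<le> \<kappa> z}"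
  have "closed S"
    using continuous_closed_preimage[OF contS closed_atLeastAtMost closed_atLeast[of r]]
    by (simp add: S_def vimage_def Int_def)
  then have "compact S" unfolding S_def by (auto simp: compact_eq_bounded_closed intro: bounded_subset[OF bounded_closed_interval])
  moreover have "\<xi> \<in> S" using \<xi>r \<xi> R by (simp add: S_def)
  ultimately obtain x where x: "x \<in> S" "\<And>z. z \<in> S \<Longrightarrow> x \<le> z"
    using compact_attains_inf[of S] by blast
  have k0: "\<kappa> 0 = 0" by (simp add: \<kappa>_def)
  have x0: "0 < x" "x \<le> \<xi>" "x < R" "r \<le> \<kappa> x"
  proof -
    show "x \<le> \<xi>" "r \<le> \<kappa> x" using x(1) by (auto simp: S_def)
    then show "x < R" using \<xi>(2) z1(2) by linarith
    have "x \<ge> 0" using x(1) by (simp add: S_def)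
    moreover have "x \<noteq> 0" using k0 r \<open>r \<le> \<kappa> x\<close> by auto
    ultimately show "0 < x" by simp
  qed
  have below: "\<kappa> z < r" if "0 < z" "z < x" for z
  proof (rule ccontr)
    assume "\<not> \<kappa> z < r"
    then have "z \<in> S" using that x0 by (simp add: S_def)
    then show False using x(2)[of z] that by simp
  qed
  have "\<exists>z\<ge>0. z \<le> x \<and> \<kappa> z = r"
    by (rule IVT') (use x0 k0 r in \<open>auto intro: continuous_on_subset[OF contS]\<close>)
  then obtain z where z: "0 \<le> z" "z \<le> x" "\<kappa> z = r" by blast
  have "z \<in> S" using z x0 by (simp add: S_def)
  then have "z = x" using x(2)[of z] z by simp
  then have "\<kappa> x = r" using z by simp
  then show ?thesis using x0 below lR[of x] unfolding \<kappa>_def by blast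
qed

lemma eventually_top_eigenvalue_less:
  assumes "top_eigenvalue \<beta> B * x < 1"
  shows "\<forall>\<^sub>F t in at 0. top_eigenvalue \<beta> (B + t) * x < 1"
proof -
  have "isCont (\<lambda>t. top_eigenvalue \<beta> (B + t) * x) 0"
    unfolding top_eigenvalue_def eigenvalue_gap_def field_trace_def by (intro continuous_intros) auto
  then have "((\<lambda>t. top_eigenvalue \<beta> (B + t) * x) \<longlongrightarrow> top_eigenvalue \<beta> B * x) (at 0)"
    by (simp add: isCont_def)
  then show ?thesis using assms by (rule order_tendstoD)
qed

lemma ln_line_gf_field_differentiable:
  assumes "\<beta> \<ge> 0" "x \<ge> 0" "top_eigenvalue \<beta> B * x < 1"
  shows "\<exists>D. ((\<lambda>t. ln (line_gf \<beta> (B + t) x)) has_real_derivative D) (at 0)"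
proof -
  have T: "((\<lambda>t. field_trace (B + t)) has_real_derivative (exp B - exp (- B))) (at 0)"
    unfolding field_trace_def by (auto intro!: derivative_eq_intros)
  have num: "((\<lambda>t. line_num \<beta> (B + t) x) has_real_derivative
      (2 * exp \<beta> * field_trace B - edge_det \<beta> * x) * (exp B - exp (- B))) (at 0)"
    unfolding line_num_def by (rule derivative_eq_intros T refl)+ (simp add: algebra_simps)
  have den: "((\<lambda>t. line_den \<beta> (B + t) x) has_real_derivative
      - exp \<beta> * (exp B - exp (- B)) * x) (at 0)"
    unfolding line_den_def by (auto intro!: derivative_eq_intros T)
  have gf: "((\<lambda>t. line_gf \<beta> (B + t) x) has_real_derivative
      ((2 * exp \<beta> * field_trace B - edge_det \<beta> * x) * (exp B - exp (- B)) * line_den \<beta> (B + 0) x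
       - line_num \<beta> (B + 0) x * (- exp \<beta> * (exp B - exp (- B)) * x))
      / (line_den \<beta> (B + 0) x * line_den \<beta> (B + 0) x)) (at 0)"
    unfolding line_gf_def using line_den_pos[OF assms] by (intro DERIV_divide num den) simp
  have "DERIV ln (line_gf \<beta> (B + 0) x) :> inverse (line_gf \<beta> (B + 0) x)"
    using line_gf_pos[OF assms] by (intro DERIV_ln) simp
  from DERIV_chain2[OF this gf] show ?thesis by blast
qed

section \<open>Exponential growth of the annealed partition function\<close>

lemma fps_power_le_graph_sum:
  "fps_nth (Abs_fps (line_weight \<beta> B) ^ m) n \<le> graph_sum \<beta> B m n"
proof (induction m arbitrary: n)
  case 0
  then show ?case using graph_sum_nonneg[of \<beta> B 0 n] by (cases n) auto
next
  case (Suc m)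
  show ?case
    unfolding fps_power_Suc_nth graph_sum_Suc
    using Suc less_imp_le[OF line_weight_pos] by (intro sum_mono mult_left_mono) auto
qed

text \<open>
  The upper bound for \<open>B'\<close> is taken at the saddle point \<open>x\<close> for \<open>B\<close>, although \<open>x\<close> is in
  general not optimal for \<open>B'\<close>. The powers of \<open>x\<close> then cancel against those in the lower bound
  for \<open>B\<close>, and what remains depends on \<open>B'\<close> through the explicit function \<open>line_gf\<close> only.
\<close>

lemma graph_sum_ratio:
  fixes m n :: "nat \<Rightarrow> nat"
  assumes \<beta>: "\<beta> \<ge> 0" and r: "r > 0"
    and x: "0 < x" "top_eigenvalue \<beta> B * x < 1"
    and crit: "x * line_gf_deriv \<beta> B x / line_gf \<beta> B x = r"
    and below: "\<And>z. 0 < z \<Longrightarrow> z < x \<Longrightarrow> z * line_gf_deriv \<beta> B z / line_gf \<beta> B z < r"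
    and x': "top_eigenvalue \<beta> B' * x < 1"
    and m: "filterlim m at_top G" and n: "((\<lambda>N. real (n N) / real (m N)) \<longlongrightarrow> r) G"
    and e: "e > 0"
  shows "\<forall>\<^sub>F N in G. graph_sum \<beta> B' (m N) (n N) \<le>
    exp (real (m N) * (ln (line_gf \<beta> B' x) - ln (line_gf \<beta> B x) + e)) * graph_sum \<beta> B (m N) (n N)"
proof -
  let ?F = "line_gf \<beta> B" and ?F' = "line_gf \<beta> B'" and ?R = "1 / top_eigenvalue \<beta> B"
  have lR: "top_eigenvalue \<beta> B * z < 1 \<longleftrightarrow> z < ?R" for z
    using top_eigenvalue_pos[of \<beta> B] by (simp add: field_simps)
  have low: "\<forall>\<^sub>F N in G. exp (real (m N) * (ln (?F x) - r * ln x - e / 2)) \<le>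
      fps_nth (Abs_fps (line_weight \<beta> B) ^ m N) (n N)"
  proof (rule fps_power_coefficient_asymp_ge[where c = "exp (- \<beta>)" and R = ?R
        and F' = "line_gf_deriv \<beta> B"])
    show "(\<lambda>k. line_weight \<beta> B k * z ^ k) sums ?F z" if "0 < z" "z < ?R" for z
      using that by (intro line_weight_sums \<beta>) (simp_all add: lR)
    show "?F z > 0" if "0 < z" "z < ?R" for z
      using that by (intro line_gf_pos \<beta>) (simp_all add: lR)
    show "(?F has_real_derivative line_gf_deriv \<beta> B z) (at z)" if "0 < z" "z < ?R" for z
      using line_den_pos[OF \<beta>, of z B] that by (intro line_gf_has_deriv) (simp add: lR)
    show "isCont (line_gf_deriv \<beta> B) x"
      using line_den_pos[OF \<beta>, of x B] x by (intro isCont_line_gf_deriv) simp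
  qed (use x lR[of x] crit below m n r e line_weight_Suc_ge[OF \<beta>] less_imp_le[OF line_weight_pos] in auto)
  have Fpos: "?F x > 0" "?F' x > 0" using x x' by (auto intro!: line_gf_pos \<beta>)
  have "\<exists>A>0. \<forall>m n. graph_sum \<beta> B' m n * x ^ n \<le> A * ?F' x ^ m"
  proof (rule convolution_recursion_upper[where K = "exp \<bar>B'\<bar> / 2"])
    show "real (Suc n) * graph_sum \<beta> B' 0 (Suc n) \<le> exp \<bar>B'\<bar> / 2 *
        (\<Sum>j\<le>n. line_weight \<beta> B' j * graph_sum \<beta> B' 0 (n - j))" for n
      using graph_sum_cycles_le[of n \<beta> B'] by (simp del: of_nat_Suc)
    show "(\<lambda>k. line_weight \<beta> B' k * x ^ k) sums ?F' x"
      using x x' by (intro line_weight_sums \<beta>) auto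
  qed (use x less_imp_le[OF line_weight_pos] graph_sum_nonneg graph_sum_Suc in auto)
  then obtain A where A: "A > 0" "\<And>m n. graph_sum \<beta> B' m n * x ^ n \<le> A * ?F' x ^ m" by blast
  have "\<forall>\<^sub>F N in G. (1 / x) ^ n N * exp (r * ln x - e / 2) ^ m N \<le> 1 / A"
    using x A e by (intro eventually_powers_le[OF m n]) (auto simp: ln_div)
  with low show ?thesis
  proof eventually_elim
    case (elim N)
    have "graph_sum \<beta> B' (m N) (n N) = graph_sum \<beta> B' (m N) (n N) * x ^ n N * (1 / x) ^ n N"
      using x by (simp add: power_divide)
    also have "\<dots> \<le> A * ?F' x ^ m N * (1 / x) ^ n N"
      using A(2) x by (intro mult_right_mono) auto
    also have "\<dots> = A * ?F' x ^ m N * exp (real (m N) * (- (r * ln x - e / 2))) *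
        ((1 / x) ^ n N * exp (r * ln x - e / 2) ^ m N)"
      by (simp add: exp_of_nat_mult[symmetric] algebra_simps flip: exp_add)
    also have "\<dots> \<le> A * ?F' x ^ m N * exp (real (m N) * (- (r * ln x - e / 2))) * (1 / A)"
      using elim(2) A Fpos by (intro mult_left_mono) auto
    also have "\<dots> = ?F' x ^ m N * exp (real (m N) * (- (r * ln x - e / 2)))"
      using A by simp
    also have "?F' x ^ m N = exp (real (m N) * ln (?F' x))"
      using Fpos by (simp add: exp_of_nat_mult)
    also have "\<dots> * exp (real (m N) * (- (r * ln x - e / 2))) =
        exp (real (m N) * (ln (?F' x) - ln (?F x) + e)) * exp (real (m N) * (ln (?F x) - r * ln x - e / 2))"
      by (simp add: algebra_simps flip: exp_add)
    also have "\<dots> \<le> exp (real (m N) * (ln (?F' x) - ln (?F x) + e)) * graph_sum \<beta> B (m N) (n N)"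
      using elim(1) fps_power_le_graph_sum[of \<beta> B "m N" "n N"] by (intro mult_left_mono) auto
    finally show ?case .
  qed
qed

section \<open>The annealed measure\<close>

lemma finite_spins: "finite (spins N)"
  by (auto simp: spins_def intro: finite_PiE)

lemma spin_cases: "\<sigma> \<in> spins N \<Longrightarrow> i \<in> {1..N} \<Longrightarrow> \<sigma> i = 1 \<or> \<sigma> i = -1"
  by (auto simp: spins_def PiE_iff)

lemma edge_energy_pairing_graph:
  "(\<Sum>e\<in>#pairing_graph P. \<Prod>i\<in>#e. \<sigma> i) = (\<Sum>e\<in>P. \<Prod>c\<in>e. \<sigma> (fst c))"
  by (simp add: pairing_graph_def sum_unfold_sum_mset prod_unfold_prod_mset
      image_mset.compositionality o_def)

lemma card_half_edges_spin:
  "card {c \<in> half_edges N d. \<tau> (fst c) = s} = (\<Sum>i | i \<in> {1..N} \<and> \<tau> i = s. d i)"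
proof -
  have "{c \<in> half_edges N d. \<tau> (fst c) = s} = (SIGMA i:{i \<in> {1..N}. \<tau> i = s}. {..<d i})"
    by (auto simp: half_edges_def)
  then show ?thesis by (simp add: card_SigmaI)
qed

definition mean_boltzmann :: "nat \<Rightarrow> (nat \<Rightarrow> nat) \<Rightarrow> real \<Rightarrow> real \<Rightarrow> (nat \<Rightarrow> real) \<Rightarrow> real" where
  "mean_boltzmann N d \<beta> B \<sigma> =
     measure_pmf.expectation (config_model N d) (\<lambda>E. boltzmann \<beta> B N E \<sigma>)"

lemma pairings_half_edges_nonempty:
  assumes "degrees12 p N d" "N \<in> even_total_degree p"
  shows "pairings (half_edges N d) \<noteq> {}"
  using assms by (intro pairings_nonempty)
    (auto simp: finite_half_edges card_half_edges_degrees12 even_total_degree_def)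

lemma mean_boltzmann_eq:
  assumes "degrees12 p N d" "N \<in> even_total_degree p" and \<sigma>: "\<sigma> \<in> spins N"
  shows "mean_boltzmann N d \<beta> B \<sigma> = exp (B * total_spin N \<sigma>) *
    spin_pairing_sum \<beta> (\<Sum>i | i \<in> {1..N} \<and> \<sigma> i = 1. d i) (\<Sum>i | i \<in> {1..N} \<and> \<sigma> i = -1. d i)
    / real (card (pairings (half_edges N d)))"
proof -
  let ?H = "half_edges N d"
  have fin: "finite ?H" by (rule finite_half_edges)
  have "mean_boltzmann N d \<beta> B \<sigma> =
      (\<Sum>P\<in>pairings ?H. boltzmann \<beta> B N (pairing_graph P) \<sigma>) / real (card (pairings ?H))"
    unfolding mean_boltzmann_def config_model_def
    using pairings_half_edges_nonempty[OF assms(1,2)] finite_pairings[OF fin]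
    by (simp add: integral_pmf_of_set)
  also have "(\<Sum>P\<in>pairings ?H. boltzmann \<beta> B N (pairing_graph P) \<sigma>) =
      (\<Sum>P\<in>pairings ?H. exp (B * total_spin N \<sigma>) * (\<Prod>e\<in>P. exp (\<beta> * (\<Prod>c\<in>e. \<sigma> (fst c)))))"
  proof (rule sum.cong[OF refl])
    fix P assume P: "P \<in> pairings ?H"
    then have "finite P" using fin finite_elements[of ?H P] by (auto simp: pairings_def)
    then show "boltzmann \<beta> B N (pairing_graph P) \<sigma> =
        exp (B * total_spin N \<sigma>) * (\<Prod>e\<in>P. exp (\<beta> * (\<Prod>c\<in>e. \<sigma> (fst c))))"
      by (simp add: boltzmann_def edge_energy_pairing_graph exp_add exp_sum sum_distrib_left)
  qed
  also have "\<dots> = exp (B * total_spin N \<sigma>) * pairing_sum (\<lambda>e. exp (\<beta> * (\<Prod>c\<in>e. \<sigma> (fst c)))) ?H"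
    by (simp add: pairing_sum_def sum_distrib_left)
  also have "pairing_sum (\<lambda>e. exp (\<beta> * (\<Prod>c\<in>e. \<sigma> (fst c)))) ?H =
      spin_pairing_sum \<beta> (card {c \<in> ?H. \<sigma> (fst c) = 1}) (card {c \<in> ?H. \<sigma> (fst c) = -1})"
    by (intro pairing_sum_spins fin spin_cases[OF \<sigma>]) (auto simp: half_edges_def)
  finally show ?thesis by (simp add: card_half_edges_spin)
qed

text \<open>
  Changing the external field tilts the annealed weights by a function of the total spin.
\<close>

lemma mean_boltzmann_tilt:
  assumes "degrees12 p N d" "N \<in> even_total_degree p" "\<sigma> \<in> spins N"
  shows "mean_boltzmann N d \<beta> (B + t) \<sigma> = exp (t * total_spin N \<sigma>) * mean_boltzmann N d \<beta> B \<sigma>"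
  by (simp add: mean_boltzmann_eq[OF assms] distrib_right exp_add)

definition mean_partition :: "nat \<Rightarrow> (nat \<Rightarrow> nat) \<Rightarrow> real \<Rightarrow> real \<Rightarrow> real" where
  "mean_partition N d \<beta> B = (\<Sum>\<sigma>\<in>spins N. mean_boltzmann N d \<beta> B \<sigma>)"

lemma annealed_weight_eq:
  assumes "degrees12 p N d" "N \<in> even_total_degree p"
  shows "annealed_weight N d \<beta> B \<sigma> = mean_boltzmann N d \<beta> B \<sigma> / mean_partition N d \<beta> B"
proof -
  have "finite (set_pmf (config_model N d))"
    using pairings_half_edges_nonempty[OF assms]
    by (simp add: config_model_def finite_pairings finite_half_edges)
  then show ?thesis
    unfolding annealed_weight_def mean_partition_def mean_boltzmann_def partition_function_def
    by (subst Bochner_Integration.integral_sum) (auto intro: integrable_measure_pmf_finite)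
qed

text \<open>
  The prefactor of \<open>graph_sum\<close> is free of \<open>B\<close>, so it cancels when two fields are compared.
\<close>

lemma mean_partition_eq_graph_sum:
  assumes d: "degrees12 p N d" and N: "N \<in> even_total_degree p"
    and mn: "n = nat \<lfloor>p * real N\<rfloor>" "2 * m + n = N"
  shows "mean_partition N d \<beta> B =
    2 ^ n * fact n * (\<Prod>i<m. real (2 * i + 1)) / real (card (pairings (half_edges N d)))
      * graph_sum \<beta> B m n"
proof -
  let ?c = "real (card (pairings (half_edges N d)))"
  have c2: "card {i \<in> {1..N}. d i = 2} = n" using d mn by (simp add: degrees12_def)
  have "card ({i \<in> {1..N}. d i = 1} \<union> {i \<in> {1..N}. d i = 2}) =
      card {i \<in> {1..N}. d i = 1} + card {i \<in> {1..N}. d i = 2}"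
    by (rule card_Un_disjoint) auto
  moreover have "{i \<in> {1..N}. d i = 1} \<union> {i \<in> {1..N}. d i = 2} = {1..N}"
    using d by (auto simp: degrees12_def)
  ultimately have "card {1..N} = card {i \<in> {1..N}. d i = 1} + card {i \<in> {1..N}. d i = 2}"
    by (simp only:)
  then have c1: "card {i \<in> {1..N}. d i = 1} = 2 * m" using c2 mn by simp
  have "mean_partition N d \<beta> B = (\<Sum>\<sigma>\<in>spins N. exp (B * (\<Sum>i\<in>{1..N}. \<sigma> i)) *
      spin_pairing_sum \<beta> (0 + (\<Sum>i | i \<in> {1..N} \<and> \<sigma> i = 1. d i))
        (0 + (\<Sum>i | i \<in> {1..N} \<and> \<sigma> i = -1. d i))) / ?c"
    unfolding mean_partition_def sum_divide_distrib
    by (rule sum.cong) (simp_all add: mean_boltzmann_eq[OF d N] total_spin_def)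
  also have "\<dots> = vertex_sum \<beta> B (2 * m) n 0 0 / ?c"
    unfolding spins_def vertex_sum_def
    by (subst sum_spins_eq_operators) (use d c1 c2 in \<open>auto simp: degrees12_def\<close>)
  also have "vertex_sum \<beta> B (2 * m) n 0 0 =
      2 ^ n * fact n * (\<Prod>i<m. real (2 * i + 1)) * graph_sum \<beta> B m n"
  proof -
    have "(\<Prod>i<m. real (2 * i + 1)) \<noteq> 0" by simp
    then show ?thesis by (simp add: graph_sum_def normalized_sum_def)
  qed
  finally show ?thesis by simp
qed

lemma mean_boltzmann_nonneg: "mean_boltzmann N d \<beta> B \<sigma> \<ge> 0"
  unfolding mean_boltzmann_def by (intro Bochner_Integration.integral_nonneg) (simp add: boltzmann_def)

lemma annealed_weight_nonneg:
  assumes "degrees12 p N d" "N \<in> even_total_degree p"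
  shows "annealed_weight N d \<beta> B \<sigma> \<ge> 0"
  unfolding annealed_weight_eq[OF assms] mean_partition_def
  by (intro divide_nonneg_nonneg sum_nonneg mean_boltzmann_nonneg)

lemma measure_annealed:
  assumes "degrees12 p N d" "N \<in> even_total_degree p" "A \<subseteq> spins N"
  shows "measure (annealed_measure N d \<beta> B) A = (\<Sum>\<sigma>\<in>A. annealed_weight N d \<beta> B \<sigma>)"
  unfolding annealed_measure_def using assms(3)
  by (subst measure_point_measure_finite_if) (auto simp: finite_spins annealed_weight_nonneg[OF assms(1,2)])

text \<open>
  Chernoff's inequality: the moment generating function of the total spin is a ratio of mean
  partition functions.
\<close>

lemma annealed_tilt_bound:
  assumes dN: "degrees12 p N d" "N \<in> even_total_degree p"
    and A: "A \<subseteq> spins N" "\<And>\<sigma>. \<sigma> \<in> A \<Longrightarrow> t * total_spin N \<sigma> \<ge> K"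
  shows "measure (annealed_measure N d \<beta> B) A \<le>
    exp (- K) * (mean_partition N d \<beta> (B + t) / mean_partition N d \<beta> B)"
proof -
  have Z: "mean_partition N d \<beta> B \<ge> 0"
    unfolding mean_partition_def by (intro sum_nonneg mean_boltzmann_nonneg)
  have "(\<Sum>\<sigma>\<in>A. mean_boltzmann N d \<beta> B \<sigma>) \<le>
      (\<Sum>\<sigma>\<in>A. exp (- K) * mean_boltzmann N d \<beta> (B + t) \<sigma>)"
  proof (rule sum_mono)
    fix \<sigma> assume \<sigma>: "\<sigma> \<in> A"
    have "1 * mean_boltzmann N d \<beta> B \<sigma> \<le> exp (t * total_spin N \<sigma> - K) * mean_boltzmann N d \<beta> B \<sigma>"
      using A(2)[OF \<sigma>] by (intro mult_right_mono mean_boltzmann_nonneg) simp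
    also have "\<dots> = exp (- K) * mean_boltzmann N d \<beta> (B + t) \<sigma>"
      using \<sigma> A(1) by (subst mean_boltzmann_tilt[OF dN]) (auto simp: exp_diff exp_minus field_simps)
    finally show "mean_boltzmann N d \<beta> B \<sigma> \<le> exp (- K) * mean_boltzmann N d \<beta> (B + t) \<sigma>" by simp
  qed
  also have "\<dots> \<le> exp (- K) * mean_partition N d \<beta> (B + t)"
    unfolding mean_partition_def sum_distrib_left[symmetric]
    using A(1) by (intro mult_left_mono sum_mono2 finite_spins mean_boltzmann_nonneg) auto
  finally have "(\<Sum>\<sigma>\<in>A. mean_boltzmann N d \<beta> B \<sigma>) / mean_partition N d \<beta> B \<le>
      exp (- K) * mean_partition N d \<beta> (B + t) / mean_partition N d \<beta> B"
    using Z by (rule divide_right_mono)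
  then show ?thesis
    unfolding measure_annealed[OF dN A(1)] annealed_weight_eq[OF dN]
      sum_divide_distrib[symmetric] times_divide_eq_right .
qed

section \<open>Concentration of the total spin\<close>

lemma admissible_le_sequentially: "admissible p \<le> sequentially"
  by (simp add: admissible_def)

lemma eventually_admissible: "\<forall>\<^sub>F N in admissible p. N \<in> even_total_degree p"
  by (simp add: admissible_def eventually_inf_principal)

lemma floor_fraction_tendsto:
  assumes "p > 0"
  shows "((\<lambda>N. real (nat \<lfloor>p * real N\<rfloor>) / real N) \<longlongrightarrow> p) sequentially"
proof (rule tendsto_sandwich)
  show "(\<lambda>N. p - inverse (real N)) \<longlonglongrightarrow> p"
    using tendsto_diff[OF tendsto_const lim_inverse_n[where 'a = real]] by simp
  have fl: "p * real N - 1 \<le> real (nat \<lfloor>p * real N\<rfloor>)" "real (nat \<lfloor>p * real N\<rfloor>) \<le> p * real N" for N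
  proof -
    have "0 \<le> p * real N" using assms by simp
    then show "p * real N - 1 \<le> real (nat \<lfloor>p * real N\<rfloor>)" "real (nat \<lfloor>p * real N\<rfloor>) \<le> p * real N"
      by linarith+
  qed
  show "\<forall>\<^sub>F N in sequentially. p - inverse (real N) \<le> real (nat \<lfloor>p * real N\<rfloor>) / real N"
    using eventually_gt_at_top[of 0]
  proof eventually_elim
    case (elim N)
    have "(p * real N - 1) / real N \<le> real (nat \<lfloor>p * real N\<rfloor>) / real N"
      by (intro divide_right_mono fl) simp
    then show ?case using elim by (simp add: diff_divide_distrib inverse_eq_divide)
  qed
  show "\<forall>\<^sub>F N in sequentially. real (nat \<lfloor>p * real N\<rfloor>) / real N \<le> p"
    using eventually_gt_at_top[of 0]
  proof eventually_elim
    case (elim N)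
    have "real (nat \<lfloor>p * real N\<rfloor>) / real N \<le> p * real N / real N"
      by (intro divide_right_mono fl) simp
    then show ?case using elim by simp
  qed
qed simp

text \<open>
  With \<open>\<Lambda> t = ln (line_gf \<beta> (B + t) x) - ln (line_gf \<beta> B x)\<close> at the saddle point \<open>x\<close> for the
  ratio \<open>r\<close> of vertices of degree 2 to pairs of leaves, the moment generating function of
  \<open>S\<^sub>N\<close> at \<open>t\<close> is at most \<open>exp (m * (\<Lambda> t + e))\<close>. As \<open>m / N\<close> tends to \<open>(1 - p) / 2\<close>, Chernoff's
  bound for deviations from \<open>M\<close> has the rate \<open>(1 - p) / 2 * \<Lambda> t - t * M - \<bar>t\<bar> * \<epsilon>\<close>. When \<open>M\<close>
  is the derivative of the first term at 0, this is negative for all small \<open>t \<noteq> 0\<close>; positive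
  \<open>t\<close> controls the upper tail and negative \<open>t\<close> the lower one.
\<close>

lemma annealed_large_deviation:
  fixes p \<beta> B :: real and d :: "nat \<Rightarrow> nat \<Rightarrow> nat"
  assumes p: "0 < p" "p < 1" and d: "\<And>N. degrees12 p N (d N)" and \<beta>: "\<beta> \<ge> 0"
  shows "\<exists>M. \<forall>\<epsilon>>0. \<exists>L>0. \<forall>\<^sub>F N in admissible p.
    measure (annealed_measure N (d N) \<beta> B)
      {\<sigma> \<in> spins N. \<bar>total_spin N \<sigma> / real N - M\<bar> \<ge> \<epsilon>} \<le> exp (- (real N * L))"
proof -
  define G where "G = admissible p"
  have Gle: "G \<le> sequentially" unfolding G_def by (rule admissible_le_sequentially)
  define n where "n N = nat \<lfloor>p * real N\<rfloor>" for N
  define m where "m N = (N - n N) div 2" for N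
  define r where "r = 2 * p / (1 - p)"
  have r: "r > 0" using p by (simp add: r_def)
  have nN: "n N \<le> N" for N
  proof -
    have "p * real N \<le> 1 * real N" using p by (intro mult_right_mono) auto
    then show ?thesis unfolding n_def by linarith
  qed
  have mn: "2 * m N + n N = N" if "N \<in> even_total_degree p" for N
    using that nN[of N] by (auto simp: m_def even_total_degree_def n_def[symmetric])
  have ev: "\<forall>\<^sub>F N in G. N \<in> even_total_degree p \<and> N > 0"
    unfolding G_def
    by (intro eventually_conj eventually_admissible filter_leD[OF admissible_le_sequentially]
        eventually_gt_at_top)
  have n_lim: "((\<lambda>N. real (n N) / real N) \<longlongrightarrow> p) G"
    unfolding n_def by (rule tendsto_mono[OF Gle floor_fraction_tendsto[OF p(1)]])
  have "((\<lambda>N. (1 - real (n N) / real N) / 2) \<longlongrightarrow> (1 - p) / 2) G"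
    by (intro tendsto_intros n_lim) simp
  then have m_lim: "((\<lambda>N. real (m N) / real N) \<longlongrightarrow> (1 - p) / 2) G"
  proof (rule Lim_transform_eventually)
    show "\<forall>\<^sub>F N in G. (1 - real (n N) / real N) / 2 = real (m N) / real N"
      using ev
    proof eventually_elim
      case (elim N)
      have "real (n N) = real N - 2 * real (m N)" using mn[of N] elim by linarith
      then have "(real N - real (n N)) / real N = 2 * real (m N) / real N" by simp
      then show ?case using elim by (simp add: diff_divide_distrib)
    qed
  qed
  have "((\<lambda>N. (real (n N) / real N) / (real (m N) / real N)) \<longlongrightarrow> p / ((1 - p) / 2)) G"
    by (rule tendsto_divide[OF n_lim m_lim]) (use p in simp)
  moreover have "p / ((1 - p) / 2) = r" by (simp add: r_def mult.commute)
  ultimately have "((\<lambda>N. (real (n N) / real N) / (real (m N) / real N)) \<longlongrightarrow> r) G" by simp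
  then have nm_lim: "((\<lambda>N. real (n N) / real (m N)) \<longlongrightarrow> r) G"
  proof (rule Lim_transform_eventually)
    show "\<forall>\<^sub>F N in G. real (n N) / real N / (real (m N) / real N) = real (n N) / real (m N)"
      using ev by eventually_elim auto
  qed
  have N_top: "filterlim (\<lambda>N. real N) at_top G"
    by (rule filterlim_mono[OF filterlim_real_sequentially order_refl Gle])
  have m_top: "filterlim m at_top G"
  proof -
    have "filterlim (\<lambda>N. (real (m N) / real N) * real N) at_top G"
      using p by (intro filterlim_tendsto_pos_mult_at_top[OF m_lim _ N_top]) simp
    then have "filterlim (\<lambda>N. real (m N)) at_top G"
      by (rule filterlim_mono_eventually[OF _ order_refl order_refl])
        (use ev in eventually_elim, simp)
    then show ?thesis by (simp add: filterlim_sequentially_iff_filterlim_real)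
  qed
  obtain x where x: "0 < x" "top_eigenvalue \<beta> B * x < 1"
      "x * line_gf_deriv \<beta> B x / line_gf \<beta> B x = r"
      "\<And>z. 0 < z \<Longrightarrow> z < x \<Longrightarrow> z * line_gf_deriv \<beta> B z / line_gf \<beta> B z < r"
    using saddle_point_exists[OF \<beta> r, of B] by blast
  obtain D where D: "((\<lambda>t. ln (line_gf \<beta> (B + t) x)) has_real_derivative D) (at 0)"
    using ln_line_gf_field_differentiable[OF \<beta> less_imp_le[OF x(1)] x(2)] by blast
  define \<Lambda> where "\<Lambda> t = ln (line_gf \<beta> (B + t) x) - ln (line_gf \<beta> B x)" for t
  define M where "M = (1 - p) / 2 * D"
  have "((\<lambda>t. (ln (line_gf \<beta> (B + (0 + t)) x) - ln (line_gf \<beta> (B + 0) x)) / t) \<longlongrightarrow> D) (at 0)"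
    using D by (simp add: DERIV_def)
  then have "((\<lambda>t. \<Lambda> t / t) \<longlongrightarrow> D) (at 0)" by (simp add: \<Lambda>_def)
  then have slope: "((\<lambda>t. (1 - p) / 2 * (\<Lambda> t / t)) \<longlongrightarrow> M) (at 0)"
    unfolding M_def by (intro tendsto_intros)
  have one_sided: "\<exists>L>0. \<forall>\<^sub>F N in G. measure (annealed_measure N (d N) \<beta> B)
      {\<sigma> \<in> spins N. s * (total_spin N \<sigma> / real N - M) \<ge> \<epsilon>} \<le> exp (- (real N * L))"
    if s: "s = 1 \<or> s = -1" and \<epsilon>: "\<epsilon> > 0" for s \<epsilon> :: real
  proof -
    have "\<forall>\<^sub>F t in at 0. (1 - p) / 2 * (\<Lambda> t / t) \<in> {M - \<epsilon> / 4<..<M + \<epsilon> / 4} \<and>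
        top_eigenvalue \<beta> (B + t) * x < 1"
      by (intro eventually_conj topological_tendstoD[OF slope] eventually_top_eigenvalue_less x)
        (use \<epsilon> in auto)
    then obtain \<delta> where \<delta>: "\<delta> > 0" "\<And>t. t \<noteq> 0 \<Longrightarrow> \<bar>t\<bar> < \<delta> \<Longrightarrow>
        (1 - p) / 2 * (\<Lambda> t / t) \<in> {M - \<epsilon> / 4<..<M + \<epsilon> / 4} \<and> top_eigenvalue \<beta> (B + t) * x < 1"
      unfolding eventually_at by (auto simp: dist_real_def)
    define h where "h = \<delta> / 2"
    have h: "h > 0" using \<delta> by (simp add: h_def)
    \<comment> \<open>The tilt \<open>t\<close> has the sign \<open>s\<close> of the tail and is so small that the scaled
      difference quotient of \<open>\<Lambda>\<close> is within \<open>\<epsilon> / 4\<close> of its limit.\<close>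
    define t where "t = s * h"
    have st: "s * t = h" "t \<noteq> 0" "\<bar>t\<bar> < \<delta>" using s h \<delta> by (auto simp: t_def h_def)
    have at: "(1 - p) / 2 * (\<Lambda> t / t) \<in> {M - \<epsilon> / 4<..<M + \<epsilon> / 4}"
        "top_eigenvalue \<beta> (B + t) * x < 1" using \<delta>(2)[OF st(2,3)] by auto
    have \<Lambda>t: "(1 - p) / 2 * \<Lambda> t \<le> t * M + h * (\<epsilon> / 4)"
    proof -
      define q where "q = (1 - p) / 2 * (\<Lambda> t / t)"
      have q: "(1 - p) / 2 * \<Lambda> t = t * q" using st by (simp add: q_def)
      have "M - \<epsilon> / 4 < q" "q < M + \<epsilon> / 4" using at(1) by (simp_all add: q_def)
      then have "s * (q - M) \<le> \<epsilon> / 4" using s by auto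
      then have "h * (s * (q - M)) \<le> h * (\<epsilon> / 4)" using h by (intro mult_left_mono) auto
      then show ?thesis unfolding q by (simp add: t_def algebra_simps)
    qed
    \<comment> \<open>A deviation by \<open>\<epsilon>\<close> gains \<open>4 * e\<close> in the exponent; the difference quotient, the
      error in the moment generating function and the convergence of \<open>m / N\<close> spend at most \<open>3 *
      e\<close> of it.\<close>
    define e where "e = h * (\<epsilon> / 4)"
    have e: "e > 0" using h \<epsilon> by (simp add: e_def)
    have lim: "((\<lambda>N. real (m N) / real N * (\<Lambda> t + e)) \<longlongrightarrow> (1 - p) / 2 * (\<Lambda> t + e)) G"
      by (rule tendsto_mult_right[OF m_lim])
    have lt: "(1 - p) / 2 * (\<Lambda> t + e) < t * M + 3 * e"
    proof -
      have "(1 - p) / 2 * e \<le> 1 * e" using p e by (intro mult_right_mono) auto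
      moreover have "u + v < w + 3 * e" if "u \<le> w + e" "v \<le> 1 * e" for u v w :: real
        using that e by linarith
      ultimately show ?thesis using \<Lambda>t by (simp only: e_def distrib_left)
    qed
    have E1: "\<forall>\<^sub>F N in G. real (m N) / real N * (\<Lambda> t + e) < t * M + 3 * e"
      by (rule order_tendstoD(2)[OF lim lt])
    have E2: "\<forall>\<^sub>F N in G. graph_sum \<beta> (B + t) (m N) (n N) \<le>
        exp (real (m N) * (\<Lambda> t + e)) * graph_sum \<beta> B (m N) (n N)"
      unfolding \<Lambda>_def by (rule graph_sum_ratio[OF \<beta> r x at(2) m_top nm_lim e])
    have "\<forall>\<^sub>F N in G. measure (annealed_measure N (d N) \<beta> B)
      {\<sigma> \<in> spins N. s * (total_spin N \<sigma> / real N - M) \<ge> \<epsilon>} \<le> exp (- (real N * e))"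
      using ev E1 E2
    proof eventually_elim
      case (elim N)
      then have N: "N \<in> even_total_degree p" "real N > 0" by auto
      let ?A = "{\<sigma> \<in> spins N. s * (total_spin N \<sigma> / real N - M) \<ge> \<epsilon>}"
      define K where "K = real N * (t * M + 4 * e)"
      have "t * total_spin N \<sigma> \<ge> K" if "\<sigma> \<in> ?A" for \<sigma>
      proof -
        have "h * \<epsilon> \<le> h * (s * (total_spin N \<sigma> / real N - M))"
          using that h by (intro mult_left_mono) auto
        then have "t * M + 4 * e \<le> t * (total_spin N \<sigma> / real N)"
          by (simp add: t_def e_def algebra_simps)
        then have "K \<le> real N * (t * (total_spin N \<sigma> / real N))"
          unfolding K_def using N by (intro mult_left_mono) auto
        then show ?thesis using N by simp
      qed
      then have "measure (annealed_measure N (d N) \<beta> B) ?A \<le>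
          exp (- K) * (mean_partition N (d N) \<beta> (B + t) / mean_partition N (d N) \<beta> B)"
        by (intro annealed_tilt_bound[OF d N(1)]) auto
      also have "mean_partition N (d N) \<beta> (B + t) / mean_partition N (d N) \<beta> B \<le>
          exp (real (m N) * (\<Lambda> t + e))"
      proof -
        have "card (pairings (half_edges N (d N))) > 0"
          using pairings_half_edges_nonempty[OF d N(1)] finite_pairings[OF finite_half_edges]
          by (simp add: card_gt_0_iff)
        moreover have "(\<Prod>i<m N. real (2 * i + 1)) > 0" by (intro prod_pos) simp
        ultimately have "mean_partition N (d N) \<beta> (B + t) / mean_partition N (d N) \<beta> B =
            graph_sum \<beta> (B + t) (m N) (n N) / graph_sum \<beta> B (m N) (n N)"
          unfolding mean_partition_eq_graph_sum[OF d N(1) n_def mn[OF N(1)]] by simp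
        also have "\<dots> \<le> exp (real (m N) * (\<Lambda> t + e))"
          using elim(3) graph_sum_nonneg[of \<beta> B "m N" "n N"]
          by (cases "graph_sum \<beta> B (m N) (n N) = 0") (simp_all add: pos_divide_le_eq less_le)
        finally show ?thesis .
      qed
      also have "exp (- K) * exp (real (m N) * (\<Lambda> t + e)) \<le> exp (- (real N * e))"
      proof -
        have "real (m N) * (\<Lambda> t + e) = real N * (real (m N) / real N * (\<Lambda> t + e))"
          using N by simp
        also have "\<dots> \<le> real N * (t * M + 3 * e)"
          using elim(2) N by (intro mult_left_mono) auto
        finally show ?thesis by (simp add: K_def algebra_simps flip: exp_add)
      qed
      finally show ?case by simp
    qed
    then show ?thesis by (intro exI[of _ e] conjI e)
  qed
  have "\<exists>L>0. \<forall>\<^sub>F N in G. measure (annealed_measure N (d N) \<beta> B)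
      {\<sigma> \<in> spins N. \<bar>total_spin N \<sigma> / real N - M\<bar> \<ge> \<epsilon>} \<le> exp (- (real N * L))"
    if \<epsilon>: "\<epsilon> > 0" for \<epsilon>
  proof -
    obtain L1 where L1: "L1 > 0" "\<forall>\<^sub>F N in G. measure (annealed_measure N (d N) \<beta> B)
        {\<sigma> \<in> spins N. 1 * (total_spin N \<sigma> / real N - M) \<ge> \<epsilon>} \<le> exp (- (real N * L1))"
      using one_sided[OF disjI1[OF refl] \<epsilon>] by (elim exE conjE)
    obtain L2 where L2: "L2 > 0" "\<forall>\<^sub>F N in G. measure (annealed_measure N (d N) \<beta> B)
        {\<sigma> \<in> spins N. -1 * (total_spin N \<sigma> / real N - M) \<ge> \<epsilon>} \<le> exp (- (real N * L2))"
      using one_sided[OF disjI2[OF refl] \<epsilon>] by (elim exE conjE)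
    \<comment> \<open>Halving the rate absorbs the factor 2 from the union of the two tails.\<close>
    define L where "L = min L1 L2 / 2"
    have L: "L > 0" "2 * L \<le> L1" "2 * L \<le> L2" using L1 L2 by (auto simp: L_def)
    have "\<forall>\<^sub>F N in G. real N > ln 2 / L"
      by (rule eventually_compose_filterlim[OF eventually_gt_at_top N_top])
    with L1(2) L2(2) ev have "\<forall>\<^sub>F N in G. measure (annealed_measure N (d N) \<beta> B)
        {\<sigma> \<in> spins N. \<bar>total_spin N \<sigma> / real N - M\<bar> \<ge> \<epsilon>} \<le> exp (- (real N * L))"
    proof eventually_elim
      case (elim N)
      let ?w = "annealed_weight N (d N) \<beta> B"
      let ?P = "{\<sigma> \<in> spins N. 1 * (total_spin N \<sigma> / real N - M) \<ge> \<epsilon>}"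
      let ?Q = "{\<sigma> \<in> spins N. -1 * (total_spin N \<sigma> / real N - M) \<ge> \<epsilon>}"
      let ?A = "{\<sigma> \<in> spins N. \<bar>total_spin N \<sigma> / real N - M\<bar> \<ge> \<epsilon>}"
      have N: "N \<in> even_total_degree p" using elim by blast
      have "?A = ?P \<union> ?Q" by (auto simp: abs_if)
      then have "sum ?w ?A \<le> sum ?w ?P + sum ?w ?Q"
        using finite_spins annealed_weight_nonneg[OF d N]
        by (simp add: sum_Un sum_nonneg)
      also have "\<dots> \<le> exp (- (real N * L1)) + exp (- (real N * L2))"
        using elim by (intro add_mono) (simp_all add: measure_annealed[OF d N])
      also have "\<dots> \<le> exp (- (real N * (2 * L))) + exp (- (real N * (2 * L)))"
        using L by (intro add_mono) (auto intro: mult_left_mono)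
      also have "\<dots> = 2 * exp (- (real N * L)) * exp (- (real N * L))"
        by (simp add: algebra_simps flip: exp_add)
      also have "\<dots> \<le> 1 * exp (- (real N * L))"
      proof (rule mult_right_mono)
        have "ln 2 < real N * L" using elim L by (simp add: field_simps)
        then have "exp (ln 2) \<le> exp (real N * L)" unfolding exp_le_cancel_iff by linarith
        then have "2 \<le> exp (real N * L)" by (simp only: exp_ln zero_less_numeral)
        then show "2 * exp (- (real N * L)) \<le> 1" by (simp add: exp_minus field_simps)
      qed simp
      finally show ?case by (simp add: measure_annealed[OF d N])
    qed
    then show ?thesis by (intro exI[of _ L] conjI L(1))
  qed
  then have "\<forall>\<epsilon>>0. \<exists>L>0. \<forall>\<^sub>F N in G. measure (annealed_measure N (d N) \<beta> B)
      {\<sigma> \<in> spins N. \<bar>total_spin N \<sigma> / real N - M\<bar> \<ge> \<epsilon>} \<le> exp (- (real N * L))"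
    by (intro allI impI)
  then show ?thesis unfolding G_def[symmetric] by (rule exI[of _ M])
qed

text \<open>
  The spin per vertex is bounded by 1, so the event of exponentially small probability
  contributes nothing to the mean in the limit.
\<close>

lemma annealed_mean_tendsto:
  assumes d: "\<And>N. degrees12 p N (d N)"
    and ld: "\<And>\<epsilon>. \<epsilon> > 0 \<Longrightarrow> \<exists>L>0. \<forall>\<^sub>F N in admissible p.
      measure (annealed_measure N (d N) \<beta> B)
        {\<sigma> \<in> spins N. \<bar>total_spin N \<sigma> / real N - M\<bar> \<ge> \<epsilon>} \<le> exp (- (real N * L))"
  shows "((\<lambda>N. integral\<^sup>L (annealed_measure N (d N) \<beta> B) (\<lambda>\<sigma>. total_spin N \<sigma> / real N)) \<longlongrightarrow> M)
    (admissible p)"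
proof (rule tendstoI)
  fix \<epsilon> :: real assume \<epsilon>: "\<epsilon> > 0"
  define C where "C = 1 + \<bar>M\<bar>"
  have C: "C > 0" by (simp add: C_def add_pos_nonneg)
  obtain L where L: "L > 0" "\<forall>\<^sub>F N in admissible p.
      measure (annealed_measure N (d N) \<beta> B)
        {\<sigma> \<in> spins N. \<bar>total_spin N \<sigma> / real N - M\<bar> \<ge> \<epsilon> / 2} \<le> exp (- (real N * L))"
    using ld[OF half_gt_zero[OF \<epsilon>]] by (elim exE conjE)
  have N_top: "filterlim (\<lambda>N. real N) at_top (admissible p)"
    by (rule filterlim_mono[OF filterlim_real_sequentially order_refl admissible_le_sequentially])
  have big: "\<forall>\<^sub>F N in admissible p. real N > max 0 (- ln (\<epsilon> / (2 * C)) / L)"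
    by (rule eventually_compose_filterlim[OF eventually_gt_at_top N_top])
  show "\<forall>\<^sub>F N in admissible p. dist (integral\<^sup>L (annealed_measure N (d N) \<beta> B)
      (\<lambda>\<sigma>. total_spin N \<sigma> / real N)) M < \<epsilon>"
    using L(2) big eventually_admissible
  proof eventually_elim
    case (elim N)
    let ?w = "annealed_weight N (d N) \<beta> B" and ?m = "\<lambda>\<sigma>. total_spin N \<sigma> / real N"
    let ?A = "{\<sigma> \<in> spins N. \<bar>?m \<sigma> - M\<bar> \<ge> \<epsilon> / 2}"
    have w: "?w \<sigma> \<ge> 0" for \<sigma> by (rule annealed_weight_nonneg[OF d elim(3)])
    interpret prob_space "annealed_measure N (d N) \<beta> B"
      by (rule prob_space_annealed_measure[OF d elim(3)])
    have one: "(\<Sum>\<sigma>\<in>spins N. ?w \<sigma>) = 1"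
      using prob_space measure_annealed[OF d elim(3), of "spins N"]
      by (simp add: annealed_measure_def space_point_measure)
    have m1: "\<bar>?m \<sigma>\<bar> \<le> 1" if "\<sigma> \<in> spins N" for \<sigma>
    proof -
      have "\<bar>total_spin N \<sigma>\<bar> \<le> (\<Sum>i\<in>{1..N}. \<bar>\<sigma> i\<bar>)" unfolding total_spin_def by (rule sum_abs)
      also have "\<dots> = (\<Sum>i\<in>{1..N}. 1)"
        by (rule sum.cong[OF refl]) (use spin_cases[OF that] in force)
      finally show ?thesis using elim(2) by (simp add: divide_le_eq)
    qed
    let ?I = "integral\<^sup>L (annealed_measure N (d N) \<beta> B) ?m"
    have "?I = (\<Sum>\<sigma>\<in>spins N. ?w \<sigma> * ?m \<sigma>)"
      unfolding annealed_measure_def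
      by (subst lebesgue_integral_point_measure_finite) (auto simp: finite_spins w)
    then have "?I - M = (\<Sum>\<sigma>\<in>spins N. ?w \<sigma> * ?m \<sigma>) - (\<Sum>\<sigma>\<in>spins N. ?w \<sigma>) * M"
      unfolding one by simp
    then have I: "?I - M = (\<Sum>\<sigma>\<in>spins N. ?w \<sigma> * (?m \<sigma> - M))"
      unfolding sum_distrib_right sum_subtractf[symmetric] right_diff_distrib .
    have A: "?w \<sigma> * \<bar>?m \<sigma> - M\<bar> \<le> ?w \<sigma> * (\<epsilon> / 2) + (if \<epsilon> / 2 \<le> \<bar>?m \<sigma> - M\<bar> then ?w \<sigma> else 0) * C"
      if \<sigma>: "\<sigma> \<in> spins N" for \<sigma>
    proof (cases "\<epsilon> / 2 \<le> \<bar>?m \<sigma> - M\<bar>")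
      case True
      have "\<bar>?m \<sigma> - M\<bar> \<le> C" using m1[OF \<sigma>] unfolding C_def by linarith
      then have "?w \<sigma> * \<bar>?m \<sigma> - M\<bar> \<le> ?w \<sigma> * C" by (rule mult_left_mono[OF _ w])
      moreover have "0 \<le> ?w \<sigma> * (\<epsilon> / 2)" using w[of \<sigma>] \<epsilon> by simp
      ultimately show ?thesis unfolding if_P[OF True] by linarith
    next
      case False
      then have "\<bar>?m \<sigma> - M\<bar> \<le> \<epsilon> / 2" by simp
      then have "?w \<sigma> * \<bar>?m \<sigma> - M\<bar> \<le> ?w \<sigma> * (\<epsilon> / 2)" by (rule mult_left_mono[OF _ w])
      then show ?thesis unfolding if_not_P[OF False] by simp
    qed
    have AA: "(\<Sum>\<sigma>\<in>spins N. if \<epsilon> / 2 \<le> \<bar>?m \<sigma> - M\<bar> then ?w \<sigma> else 0) = (\<Sum>\<sigma>\<in>?A. ?w \<sigma>)"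
      by (rule sum.inter_filter[OF finite_spins, symmetric])
    have "\<bar>?I - M\<bar> \<le> (\<Sum>\<sigma>\<in>spins N. \<bar>?w \<sigma> * (?m \<sigma> - M)\<bar>)"
      unfolding I by (rule sum_abs)
    also have "\<dots> = (\<Sum>\<sigma>\<in>spins N. ?w \<sigma> * \<bar>?m \<sigma> - M\<bar>)"
      using w by (simp add: abs_mult)
    also have "\<dots> \<le> (\<Sum>\<sigma>\<in>spins N. ?w \<sigma> * (\<epsilon> / 2) + (if \<epsilon> / 2 \<le> \<bar>?m \<sigma> - M\<bar> then ?w \<sigma> else 0) * C)"
      by (rule sum_mono) (rule A)
    also have "\<dots> = \<epsilon> / 2 + (\<Sum>\<sigma>\<in>?A. ?w \<sigma>) * C"
      unfolding sum.distrib sum_distrib_right[symmetric] AA one by simp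
    finally have "\<bar>?I - M\<bar> \<le> \<epsilon> / 2 + (\<Sum>\<sigma>\<in>?A. ?w \<sigma>) * C" .
    moreover have "(\<Sum>\<sigma>\<in>?A. ?w \<sigma>) * C \<le> exp (- (real N * L)) * C"
      using elim(1) C by (intro mult_right_mono) (simp_all add: measure_annealed[OF d elim(3)])
    moreover have "exp (- (real N * L)) * C < \<epsilon> / 2"
    proof -
      have "- ln (\<epsilon> / (2 * C)) / L < real N" using elim(2) by simp
      then have "- ln (\<epsilon> / (2 * C)) < real N * L" using L(1) by (simp only: pos_divide_less_eq)
      then have "exp (- (real N * L)) < exp (ln (\<epsilon> / (2 * C)))" unfolding exp_less_cancel_iff by linarith
      then have "exp (- (real N * L)) < \<epsilon> / (2 * C)" using C \<epsilon> by simp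
      then show ?thesis using C by (simp add: field_simps)
    qed
    ultimately show ?case unfolding dist_real_def by linarith
  qed
qed

text \<open>
  If the filter is trivial there is nothing to show; otherwise limits along it are unique,
  which identifies the centre of concentration with the annealed magnetization.
\<close>

theorem theorem1p8:
  fixes p :: real and d :: "nat \<Rightarrow> nat \<Rightarrow> nat" and \<beta> B \<epsilon> :: real
  assumes "0 < p" and "p < 1"
    and "\<And>N. degrees12 p N (d N)"
    and "\<beta> \<ge> 0" and "\<epsilon> > 0"
  shows "\<exists>L>0. \<forall>\<^sub>F N in admissible p.
    measure (annealed_measure N (d N) \<beta> B)
      {\<sigma> \<in> spins N. \<bar>total_spin N \<sigma> / real N - annealed_magnetization p d \<beta> B\<bar> \<ge> \<epsilon>}
    \<le> exp (- (real N * L))"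
proof (cases "admissible p = bot")
  case True
  then show ?thesis by (intro exI[of _ 1]) simp
next
  case False
  have "\<exists>M. \<forall>\<epsilon>>0. \<exists>L>0. \<forall>\<^sub>F N in admissible p.
    measure (annealed_measure N (d N) \<beta> B)
      {\<sigma> \<in> spins N. \<bar>total_spin N \<sigma> / real N - M\<bar> \<ge> \<epsilon>} \<le> exp (- (real N * L))"
    by (rule annealed_large_deviation) (rule assms)+
  then obtain M where M: "\<forall>\<epsilon>>0. \<exists>L>0. \<forall>\<^sub>F N in admissible p.
    measure (annealed_measure N (d N) \<beta> B)
      {\<sigma> \<in> spins N. \<bar>total_spin N \<sigma> / real N - M\<bar> \<ge> \<epsilon>} \<le> exp (- (real N * L))" ..
  have "annealed_magnetization p d \<beta> B = M"
    unfolding annealed_magnetization_def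
  proof (rule tendsto_Lim[OF False annealed_mean_tendsto])
    show "degrees12 p N (d N)" for N by (rule assms)
  qed (rule M[rule_format])
  then show ?thesis using M[rule_format, OF \<open>\<epsilon> > 0\<close>] by (simp only:)
qed

end
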